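(* Let $\mathbb{K}\in\{\mathbb{R},\mathbb{C}\}$ and let $\ell,n,m\in\mathbb{N}^*$. Then the following equivalences hold: (i) $S^H_{\text{freely initializable}}$ is relative generic in $\Sigma^H_{\ell,n,m}$ $\iff$ $\ell\le n+m$; (ii) $S^H_{\text{impulse controllable}}$ is relative generic in $\Sigma^H_{\ell,n,m}$ $\iff$ $\ell\le n+m$; (iii) $S^H_{\text{behavioural controllable}}$ is relative generic in $\Sigma^H_{\ell,n,m}$ $\iff$ $\ell\neq n+m$; (iv) $S^H_{\text{completely controllable}}$ is relative generic in $\Sigma^H_{\ell,n,m}$ $\iff$ $\ell<n+m$; (v) $S^H_{\text{strongly controllable}}$ is relative generic in $\Sigma^H_{\ell,n,m}$ $\iff$ $\ell<n+m$. Moreover, for each of the five concepts "controllable" $\in\{$freely initializable, impulse controllable, behavioural controllable, completely controllable, strongly controllable$\}$: if $S^H_{\text{controllable}}$ is not relative generic in $\Sigma^H_{\ell,n,m}$, then its complement $(S^H_{\text{controllable}})^c$ is relative generic in $\Sigma^H_{\ell,n,m}$. Furthermore, for each $\star\in\{sdH,dH\}$: $S^{\star}_{\text{freely initializable}}$ is relative generic in $\Sigma^{\star}_{\ell,n,m}$ $\iff$ $\ell\le n+m$; $S^{\star}_{\text{impulse controllable}}$ is relative generic in $\Sigma^{\star}_{\ell,n,m}$ $\iff$ $\ell\le n+m$; $S^{\star}_{\text{behavioural controllable}}$ is relative generic in $\Sigma^{\star}_{\ell,n,m}$ $\iff$ $\ell\neq n+m$; $S^{\star}_{\text{completely controllable}}$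 is relative generic in $\Sigma^{\star}_{\ell,n,m}$ $\iff$ $\ell<n+m$; $S^{\star}_{\text{strongly controllable}}$ is relative generic in $\Sigma^{\star}_{\ell,n,m}$ $\iff$ $\ell<n+m$; and, for each of the five concepts, if $S^{\star}_{\text{controllable}}$ is not relative generic in $\Sigma^{\star}_{\ell,n,m}$, then its complement $(S^{\star}_{\text{controllable}})^c$ is relative generic in $\Sigma^{\star}_{\ell,n,m}$.
   Context: $\mathbb{N}^*=\{1,2,\dots\}$; $\mathbb{K}$ is $\mathbb{R}$ or $\mathbb{C}$; $M^*$ is the conjugate transpose (transpose if $\mathbb{K}=\mathbb{R}$); $M\ge 0$ ($M>0$) means Hermitian/symmetric positive semidefinite (definite). Port-Hamiltonian descriptor systems are $\frac{d}{dt}Ex=(J-R)Qx+Bu$. Reference sets: $\Sigma^{H}_{\ell,n,m}=\{(E,J,Q,B)\in\mathbb{K}^{\ell\times n}\times\mathbb{K}^{\ell\times\ell}\times\mathbb{K}^{\ell\times n}\times\mathbb{K}^{\ell\times m} : J=-J^*,\ E^*Q=Q^*E\ge0\}$; $\Sigma^{sdH}_{\ell,n,m}=\{(E,J,R,Q,B)\in\mathbb{K}^{\ell\times n}\times\mathbb{K}^{\ell\times\ell}\times\mathbb{K}^{\ell\times\ell}\times\mathbb{K}^{\ell\times n}\times\mathbb{K}^{\ell\times m} : J=-J^*,\ R=R^*\ge0,\ E^*Q=Q^*E\ge0\}$; $\Sigma^{dH}_{\ell,n,m}$ is defined as $\Sigma^{sdH}_{\ell,n,m}$ but with $R=R^*>0$.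 Controllability of $(E,A,B)\in\Sigma_{\ell,n,m}:=\mathbb{K}^{\ell\times n}\times\mathbb{K}^{\ell\times n}\times\mathbb{K}^{\ell\times m}$, i.e. of $\frac{d}{dt}Ex=Ax+Bu$ ($\mathrm{rk}$ without subscript is the rank of a constant matrix; $\mathrm{rk}_{\mathbb{K}(x)}$ is the rank over the field of rational functions): - freely initializable: $\mathrm{rk}[E,B]=\mathrm{rk}[E,A,B]$; - impulse controllable: for every $Z\in\mathbb{K}^{n\times(n-\mathrm{rk}E)}$ with $\mathrm{im}\,Z=\ker E$, $\mathrm{rk}[E,A,B]=\mathrm{rk}[E,AZ,B]$; - behavioural controllable: for all $\lambda\in\mathbb{C}$, $\mathrm{rk}_{\mathbb{K}(x)}[xE-A,B]=\mathrm{rk}_{\mathbb{C}}[\lambda E-A,B]$; - completely controllable: for all $\lambda\in\mathbb{C}$, $\mathrm{rk}[E,A,B]=\mathrm{rk}[E,B]=\mathrm{rk}[\lambda E-A,B]$ (equivalently, freely initializable and behavioural controllable); - strongly controllable: for every $Z\in\mathbb{K}^{n\times(n-\mathrm{rk}E)}$ with $\mathrm{im}\,Z=\ker E$ and all $\lambda\in\mathbb{C}$, $\mathrm{rk}[E,A,B]=\mathrm{rk}[E,AZ,B]=\mathrm{rk}[\lambda E-A,B]$ (equivalently, impulse controllable and behavioural controllable). $S_{\text{controllable}}\subseteq\Sigma_{\ell,n,m}$ is the set of triples with the respective property, and $S^H_{\text{controllable}}=\{(E,J,Q,B)\in\Sigma^H_{\ell,n,m}:(E,JQ,B)\in S_{\text{controllable}}\}$,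 $S^{dH}_{\text{controllable}}=\{(E,J,R,Q,B)\in\Sigma^{dH}_{\ell,n,m}:(E,(J-R)Q,B)\in S_{\text{controllable}}\}$, and $S^{sdH}_{\text{controllable}}$ likewise with $\Sigma^{sdH}_{\ell,n,m}$. Relative genericity: an algebraic set in $\mathbb{R}^N$ is the common zero set of finitely many real polynomials in $N$ indeterminates. For $S,V\subseteq\mathbb{R}^N$, $S$ is relative generic in $V$ iff there is an algebraic set $\mathbb{V}\subseteq\mathbb{R}^N$ with $S^c\cap V\subseteq\mathbb{V}\cap V$ and $\mathbb{V}^c\cap V$ Euclidean dense in $V$. Spaces of (tuples of) matrices over $\mathbb{K}$ are identified with some $\mathbb{R}^N$ by a real vector space isomorphism (in particular $\mathbb{C}^N\cong\mathbb{R}^{2N}$); the notion does not depend on the isomorphism. Complements are taken in the ambient matrix space. *)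

theory Defs
  imports "HOL-Analysis.Analysis" "HOL-Computational_Algebra.Computational_Algebra"
begin

section \<open>The scalar field\<close>

text \<open>
  The axioms say that the type is isomorphic, via \<open>to_complex\<close> and compatibly with the real
  vector space structure and the norm, either to the reals or to the complex numbers;
  \<open>conjg\<close> is the conjugation, which is the identity in the real case.
\<close>

class real_or_complex = real_normed_field + euclidean_space +
  fixes to_complex :: "'a \<Rightarrow> complex"
    and conjg :: "'a \<Rightarrow> 'a"
  assumes to_complex_add: "to_complex (x + y) = to_complex x + to_complex y"
    and to_complex_mult: "to_complex (x * y) = to_complex x * to_complex y"
    and to_complex_scaleR: "to_complex (r *\<^sub>R x) = r *\<^sub>R to_complex x"
    and norm_to_complex: "norm (to_complex x) = norm x"
    and range_to_complex: "range to_complex = \<real> \<or> range to_complex = UNIV"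
    and to_complex_conjg: "to_complex (conjg x) = cnj (to_complex x)"

instantiation real :: real_or_complex
begin

definition "to_complex_real = complex_of_real"
definition "conjg_real = (id :: real \<Rightarrow> real)"

instance
  by standard (auto simp: to_complex_real_def conjg_real_def scaleR_conv_of_real Reals_def)

end

instantiation complex :: real_or_complex
begin

definition "to_complex_complex = (id :: complex \<Rightarrow> complex)"
definition "conjg_complex = cnj"

instance
  by standard (auto simp: to_complex_complex_def conjg_complex_def)

end


section \<open>Relative genericity\<close>

text \<open>
  A finite-dimensional real vector space carrying its norm topology plays the role of
  \<open>\<real>\<^sup>N\<close>.  There every linear functional is bounded and is a linear form in the
  coordinates, so \<^const>\<open>real_polynomial_function\<close> describes exactly the
  functions given by real polynomials in \<open>N = DIM('a)\<close> indeterminates, for any choice of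
  linear coordinates.
\<close>

definition algebraic_set :: "'a::euclidean_space set \<Rightarrow> bool" where
  "algebraic_set \<V> \<longleftrightarrow>
     (\<exists>P. finite P \<and> (\<forall>p\<in>P. real_polynomial_function p) \<and> \<V> = {x. \<forall>p\<in>P. p x = 0})"

definition relative_generic :: "'a::euclidean_space set \<Rightarrow> 'a set \<Rightarrow> bool" where
  "relative_generic S V \<longleftrightarrow>
     (\<exists>\<V>. algebraic_set \<V> \<and> - S \<inter> V \<subseteq> \<V> \<inter> V \<and> V \<subseteq> closure (- \<V> \<inter> V))"


section \<open>Matrices\<close>

definition adj :: "'k::real_or_complex^'n^'m \<Rightarrow> 'k^'m^'n" where
  "adj M = (\<chi> i j. conjg (M $ j $ i))"

definition quad_form :: "'k::real_or_complex^'n^'n \<Rightarrow> 'k^'n \<Rightarrow> 'k" where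
  "quad_form M x = (\<Sum>i\<in>UNIV. conjg (x $ i) * (M *v x) $ i)"

text \<open>The values of the quadratic form of a Hermitian matrix are real.\<close>

definition pos_semidef :: "'k::real_or_complex^'n^'n \<Rightarrow> bool" where
  "pos_semidef M \<longleftrightarrow> M = adj M \<and> (\<forall>x. 0 \<le> Re (to_complex (quad_form M x)))"

definition pos_def :: "'k::real_or_complex^'n^'n \<Rightarrow> bool" where
  "pos_def M \<longleftrightarrow> M = adj M \<and> (\<forall>x. x \<noteq> 0 \<longrightarrow> 0 < Re (to_complex (quad_form M x)))"

definition hcat :: "'a^'n^'l \<Rightarrow> 'a^'m^'l \<Rightarrow> 'a^('n + 'm)^'l" where
  "hcat A B = (\<chi> i j. case j of Inl a \<Rightarrow> A $ i $ a | Inr b \<Rightarrow> B $ i $ b)"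

definition pencil_complex ::
    "complex \<Rightarrow> 'k::real_or_complex^'n^'l \<Rightarrow> 'k^'n^'l \<Rightarrow> 'k^'m^'l \<Rightarrow> complex^('n + 'm)^'l" where
  "pencil_complex z E A B =
     hcat (\<chi> i j. z * to_complex (E $ i $ j) - to_complex (A $ i $ j))
          (\<chi> i j. to_complex (B $ i $ j))"

text \<open>The field \<open>\<bbbK>(x)\<close> is the fraction field of the polynomial ring \<^typ>\<open>'k poly\<close>.\<close>

definition pencil_rat ::
    "'k::real_or_complex^'n^'l \<Rightarrow> 'k^'n^'l \<Rightarrow> 'k^'m^'l \<Rightarrow> 'k poly fract^('n + 'm)^'l" where
  "pencil_rat E A B =
     hcat (\<chi> i j. Fraction_Field.Fract [:- (A $ i $ j), E $ i $ j:] 1)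
          (\<chi> i j. Fraction_Field.Fract [:B $ i $ j:] 1)"

text \<open>
  The number of columns of \<open>Z \<in> \<bbbK>\<^sup>n\<^sup>\<times>\<^sup>d\<close> with \<open>d = n - rk E\<close>
  depends on \<open>E\<close> and so cannot be a type.  Such a matrix is given by its columns
  \<open>Z 0, \<dots>, Z (d - 1)\<close>; then \<open>im Z\<close> is their span, and the rank of
  \<open>[E, AZ, B]\<close> is the dimension of the column space.  The lemmas below check this against
  \<^const>\<open>rank\<close> (which the library defines as row rank) when the columns are indexed by a type.
\<close>

definition im_cols :: "nat \<Rightarrow> (nat \<Rightarrow> 'k::field^'n) \<Rightarrow> ('k^'n) set" where
  "im_cols d Z = vec.span (Z ` {..<d})"

definition rank_EAZB ::
    "'k::field^'n^'l \<Rightarrow> 'k^'n^'l \<Rightarrow> nat \<Rightarrow> (nat \<Rightarrow> 'k^'n) \<Rightarrow> 'k^'m^'l \<Rightarrow> nat" where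
  "rank_EAZB E A d Z B =
     vec.dim (columns E \<union> (\<lambda>j. A *v Z j) ` {..<d} \<union> columns B)"

lemma dim_rows_le_dim_columns:
  fixes A :: "'k::field^'n^'m"
  shows "vec.dim (rows A) \<le> vec.dim (columns A)"
proof -
  obtain Bs where Bs: "Bs \<subseteq> columns A" "vec.independent Bs" "columns A \<subseteq> vec.span Bs"
      "card Bs = vec.dim (columns A)"
    using vec.basis_exists by blast
  have fin: "finite Bs"
    using Bs(2) vec.finiteI_independent by blast
  have "\<exists>u. column j A = (\<Sum>b\<in>Bs. u b *s b)" for j
  proof -
    have "column j A \<in> vec.span Bs"
      using Bs(3) by (auto simp: columns_def)
    then show ?thesis
      using vec.span_finite[OF fin] by auto
  qed
  then obtain u where u: "\<And>j. column j A = (\<Sum>b\<in>Bs. u j b *s b)"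
    by metis
  define r where "r b = (\<chi> j. u j b)" for b
  have row_eq: "row i A = (\<Sum>b\<in>Bs. (b $ i) *s r b)" for i
  proof -
    have "row i A $ j = (\<Sum>b\<in>Bs. (b $ i) *s r b) $ j" for j
    proof -
      have "row i A $ j = column j A $ i"
        by (simp add: row_def column_def)
      also have "\<dots> = (\<Sum>b\<in>Bs. u j b * b $ i)"
        by (subst u) simp
      finally show ?thesis
        by (simp add: r_def mult.commute)
    qed
    then show ?thesis
      by (simp add: vec_eq_iff)
  qed
  have "rows A \<subseteq> vec.span (r ` Bs)"
  proof
    fix v assume "v \<in> rows A"
    then obtain i where "v = row i A"
      by (auto simp: rows_def)
    then show "v \<in> vec.span (r ` Bs)"
      by (simp only: row_eq) (intro vec.span_sum vec.span_scale vec.span_base imageI)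
  qed
  then have "vec.dim (rows A) \<le> card (r ` Bs)"
    using fin by (intro vec.dim_le_card) auto
  also have "\<dots> \<le> card Bs"
    by (rule card_image_le[OF fin])
  finally show ?thesis
    by (simp add: Bs(4))
qed

lemma rank_eq_dim_columns:
  fixes A :: "'k::field^'n^'m"
  shows "rank A = vec.dim (columns A)"
proof -
  have "vec.dim (columns A) \<le> vec.dim (rows A)"
    using dim_rows_le_dim_columns[of "transpose A"] by simp
  then show ?thesis
    using dim_rows_le_dim_columns[of A] by (simp add: row_rank_def_gen)
qed

lemma columns_hcat: "columns (hcat A B) = columns A \<union> columns B"
proof -
  have "column (Inl a) (hcat A B) = column a A" "column (Inr b) (hcat A B) = column b B" for a b
    by (simp_all add: column_def hcat_def vec_eq_iff)
  moreover have "columns (hcat A B)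
      = range (\<lambda>a. column (Inl a) (hcat A B)) \<union> range (\<lambda>b. column (Inr b) (hcat A B))"
    unfolding columns_def UNIV_sum by blast
  ultimately show ?thesis
    by (simp add: columns_def full_SetCompr_eq)
qed

lemma columns_matrix_mult: "columns (A ** Z) = (\<lambda>z. A *v z) ` columns (Z :: 'k::field^'d^'n)"
proof -
  have "column j (A ** Z) = A *v column j Z" for j
    by (simp add: column_def matrix_matrix_mult_def matrix_vector_mult_def vec_eq_iff)
  then show ?thesis
    by (auto simp: columns_def)
qed

lemma
  fixes W :: "'k::field^'d^'n"
  assumes "Z ` {..<d} = columns W"
  shows im_cols_eq: "im_cols d Z = range (\<lambda>x. W *v x)"
    and rank_EAZB_eq: "rank_EAZB E A d Z B = rank (hcat E (hcat (A ** W) B))"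
proof -
  have "range (\<lambda>x. W *v x) = vec.span (columns W)"
  proof
    show "range (\<lambda>x. W *v x) \<subseteq> vec.span (columns W)"
      unfolding matrix_mult_sum
      by (intro image_subsetI vec.span_sum vec.span_scale vec.span_base) (auto simp: columns_def)
    have "column j W = W *v axis j 1" for j
      by (simp add: column_def matrix_vector_mult_def axis_def vec_eq_iff if_distrib cong: if_cong)
    then have "columns W \<subseteq> range (\<lambda>x. W *v x)"
      by (auto simp: columns_def)
    moreover have "vec.subspace (range (\<lambda>x. W *v x))"
      unfolding vec.subspace_def
    proof (intro conjI ballI allI)
      show "0 \<in> range (\<lambda>x. W *v x)"
        by (rule range_eqI[of _ _ 0]) simp
    next
      fix x y assume "x \<in> range (\<lambda>x. W *v x)" "y \<in> range (\<lambda>x. W *v x)"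
      then show "x + y \<in> range (\<lambda>x. W *v x)"
        by (auto simp: matrix_vector_right_distrib[symmetric])
    next
      fix c x assume "x \<in> range (\<lambda>x. W *v x)"
      then show "c *s x \<in> range (\<lambda>x. W *v x)"
        by (auto simp: vector_scalar_commute[symmetric])
    qed
    ultimately show "vec.span (columns W) \<subseteq> range (\<lambda>x. W *v x)"
      by (rule vec.span_minimal)
  qed
  then show "im_cols d Z = range (\<lambda>x. W *v x)"
    by (simp add: im_cols_def assms)
  have "(\<lambda>j. A *v Z j) ` {..<d} = (\<lambda>z. A *v z) ` columns W"
    using assms by (metis image_image)
  then show "rank_EAZB E A d Z B = rank (hcat E (hcat (A ** W) B))"
    by (simp add: rank_EAZB_def rank_eq_dim_columns columns_hcat columns_matrix_mult Un_assoc)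
qed


section \<open>Controllability of descriptor systems\<close>

definition freely_initializable ::
    "(('k::real_or_complex^'n^'l) \<times> ('k^'n^'l) \<times> ('k^'m^'l)) set" where
  "freely_initializable = {(E, A, B). rank (hcat E B) = rank (hcat E (hcat A B))}"

definition impulse_controllable ::
    "(('k::real_or_complex^'n^'l) \<times> ('k^'n^'l) \<times> ('k^'m^'l)) set" where
  "impulse_controllable = {(E, A, B).
     let d = CARD('n) - rank E in
     \<forall>Z. im_cols d Z = {x. E *v x = 0} \<longrightarrow> rank (hcat E (hcat A B)) = rank_EAZB E A d Z B}"

definition behavioural_controllable ::
    "(('k::real_or_complex^'n^'l) \<times> ('k^'n^'l) \<times> ('k^'m^'l)) set" where
  "behavioural_controllable = {(E, A, B).
     \<forall>z. rank (pencil_rat E A B) = rank (pencil_complex z E A B)}"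

definition completely_controllable ::
    "(('k::real_or_complex^'n^'l) \<times> ('k^'n^'l) \<times> ('k^'m^'l)) set" where
  "completely_controllable = {(E, A, B).
     \<forall>z. rank (hcat E (hcat A B)) = rank (hcat E B) \<and>
         rank (hcat E B) = rank (pencil_complex z E A B)}"

definition strongly_controllable ::
    "(('k::real_or_complex^'n^'l) \<times> ('k^'n^'l) \<times> ('k^'m^'l)) set" where
  "strongly_controllable = {(E, A, B).
     let d = CARD('n) - rank E in
     \<forall>Z. im_cols d Z = {x. E *v x = 0} \<longrightarrow>
       (\<forall>z. rank (hcat E (hcat A B)) = rank_EAZB E A d Z B \<and>
            rank_EAZB E A d Z B = rank (pencil_complex z E A B))}"


section \<open>Port-Hamiltonian reference sets\<close>

type_synonym ('k, 'l, 'n, 'm) H_tuple =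
  "(('k, 'n) vec, 'l) vec \<times> (('k, 'l) vec, 'l) vec \<times> (('k, 'n) vec, 'l) vec \<times> (('k, 'm) vec, 'l) vec"

type_synonym ('k, 'l, 'n, 'm) dH_tuple =
  "(('k, 'n) vec, 'l) vec \<times> (('k, 'l) vec, 'l) vec \<times> (('k, 'l) vec, 'l) vec \<times> (('k, 'n) vec, 'l) vec
     \<times> (('k, 'm) vec, 'l) vec"

definition Sigma_H :: "('k::real_or_complex, 'l::finite, 'n::finite, 'm::finite) H_tuple set" where
  "Sigma_H = {(E, J, Q, B).
     J = - adj J \<and> adj E ** Q = adj Q ** E \<and> pos_semidef (adj E ** Q)}"

definition Sigma_sdH ::
    "('k::real_or_complex, 'l::finite, 'n::finite, 'm::finite) dH_tuple set" where
  "Sigma_sdH = {(E, J, R, Q, B).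
     J = - adj J \<and> pos_semidef R \<and> adj E ** Q = adj Q ** E \<and> pos_semidef (adj E ** Q)}"

definition Sigma_dH ::
    "('k::real_or_complex, 'l::finite, 'n::finite, 'm::finite) dH_tuple set" where
  "Sigma_dH = {(E, J, R, Q, B).
     J = - adj J \<and> pos_def R \<and> adj E ** Q = adj Q ** E \<and> pos_semidef (adj E ** Q)}"

definition S_H ::
    "(('k::real_or_complex^'n^'l) \<times> ('k^'n^'l) \<times> ('k^'m^'l)) set \<Rightarrow>
     ('k, 'l, 'n, 'm) H_tuple set" where
  "S_H C = {(E, J, Q, B). (E, J, Q, B) \<in> Sigma_H \<and> (E, J ** Q, B) \<in> C}"

definition S_sdH ::
    "(('k::real_or_complex^'n^'l) \<times> ('k^'n^'l) \<times> ('k^'m^'l)) set \<Rightarrow>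
     ('k, 'l, 'n, 'm) dH_tuple set" where
  "S_sdH C = {(E, J, R, Q, B). (E, J, R, Q, B) \<in> Sigma_sdH \<and> (E, (J - R) ** Q, B) \<in> C}"

definition S_dH ::
    "(('k::real_or_complex^'n^'l) \<times> ('k^'n^'l) \<times> ('k^'m^'l)) set \<Rightarrow>
     ('k, 'l, 'n, 'm) dH_tuple set" where
  "S_dH C = {(E, J, R, Q, B). (E, J, R, Q, B) \<in> Sigma_dH \<and> (E, (J - R) ** Q, B) \<in> C}"

end

theory Submission
  imports Defs
begin

text \<open>
  The pairs \<open>(M E, E)\<close> with \<open>M \<ge> 0\<close> are dense among the pairs \<open>(Q, E)\<close> with
  \<open>E\<^sup>* Q = Q\<^sup>* E \<ge> 0\<close>, and the parameters \<open>(E, J, R, M, B)\<close> range over a convex set.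
  Restricted to a segment in the parameters, a real polynomial is a polynomial in one variable, so
  a polynomial that does not vanish at one parameter point is nonzero on a dense subset of the
  reference set.  Genericity is thus reduced to exhibiting one triple
  with the required property, provided the property is implied by the injectivity of a matrix
  depending polynomially on the data.  The triple consists of 0-1 matrices \<open>E\<close> and \<open>B\<close> and the
  tridiagonal skew-symmetric matrix \<open>J\<close>, with \<open>M = 1\<close> and \<open>R = 0\<close>; for the dissipative
  reference set it is only an end point of the segments.

  For \<open>\<ell> < n + m\<close> the pencil has full row rank everywhere, for \<open>\<ell> > n + m\<close> full column rank
  everywhere but \<open>rk [E, A, B] > n + m \<ge> rk [E, B]\<close>, and for \<open>\<ell> = n + m\<close> the
  matrix \<open>[E, B]\<close> is invertible, so that the square pencil is regular and has an eigenvalue.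
\<close>

text \<open>A pair with \<open>E = 0\<close> and \<open>Q \<noteq> 0\<close> is not of the form
  \<open>Q = M E\<close>, so the density argument has to move \<open>E\<close> as well:
  \<open>E\<close> becomes \<open>E + e Q\<close>, and \<open>M\<close> solves
  \<open>M (E + e Q) = Q\<close> up to a regularisation. In general \<open>M\<close> is unbounded as
  \<open>e\<close> tends to 0. A rank condition for all complex \<open>z\<close> fails on a
  projection, which is not visibly algebraic. Chain matrices, free of \<open>z\<close>, replace it
  by one injectivity condition; a chain supported on its last member plays the role of the
  eigenvalue at infinity and also yields the rank of \<open>[E, B]\<close>. The rank over the
  rational functions then follows from that of \<open>[E, B]\<close> by comparing coefficients. With
  \<open>E\<close> a padded identity and \<open>J\<close> tridiagonal, a chain is a recurrence
  between an entry of one member and the two neighbouring entries of the previous member. Zeros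
  forced at one end by \<open>B\<close>, or by a row that \<open>E\<close> and \<open>B\<close> both
  miss, spread by one entry per chain member, so \<ell> + 1 members are enough. The same
  \<open>J\<close> sends the last column of \<open>E\<close> into that missed row, which gives rank
  n + m + 1 for \<ell> > n + m.\<close>

no_notation fps_nth (infixl \<open>$\<close> 75)

section \<open>Scalars\<close>

lemma to_complex_0 [simp]: "to_complex 0 = 0"
  using to_complex_scaleR[of 0 0] by simp

lemma to_complex_eq_0_iff [simp]: "to_complex x = 0 \<longleftrightarrow> x = 0"
  by (metis norm_eq_zero norm_to_complex)

lemma to_complex_1 [simp]: "to_complex (1 :: 'k::real_or_complex) = 1"
  using to_complex_mult[of "1 :: 'k" 1] by simp

lemma to_complex_minus [simp]: "to_complex (- x) = - to_complex x"
  using to_complex_scaleR[of "- 1" x] by simp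

lemma to_complex_diff: "to_complex (x - y) = to_complex x - to_complex y"
  using to_complex_add[of x "- y"] by simp

lemma to_complex_sum: "to_complex (sum f A) = (\<Sum>x\<in>A. to_complex (f x))"
  by (induction A rule: infinite_finite_induct) (auto simp: to_complex_add)

lemma to_complex_inject [simp]: "to_complex x = to_complex y \<longleftrightarrow> x = y"
  using to_complex_diff[of x y] by (metis right_minus_eq to_complex_eq_0_iff)

lemma linear_to_complex: "linear to_complex"
  by (intro linearI) (auto simp: to_complex_add to_complex_scaleR)

lemma conjg_0 [simp]: "conjg 0 = 0"
  by (simp flip: to_complex_inject add: to_complex_conjg)

lemma conjg_1 [simp]: "conjg 1 = 1"
  by (simp flip: to_complex_inject add: to_complex_conjg)

lemma conjg_conjg [simp]: "conjg (conjg x) = x"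
  by (simp flip: to_complex_inject add: to_complex_conjg)

lemma conjg_add: "conjg (x + y) = conjg x + conjg y"
  by (simp flip: to_complex_inject add: to_complex_conjg to_complex_add)

lemma conjg_minus [simp]: "conjg (- x) = - conjg x"
  by (simp flip: to_complex_inject add: to_complex_conjg)

lemma conjg_mult: "conjg (x * y) = conjg x * conjg y"
  by (simp flip: to_complex_inject add: to_complex_conjg to_complex_mult)

lemma conjg_scaleR: "conjg (r *\<^sub>R x) = r *\<^sub>R conjg x"
  by (simp flip: to_complex_inject add: to_complex_conjg to_complex_scaleR)

lemma conjg_sum: "conjg (sum f A) = (\<Sum>x\<in>A. conjg (f x))"
  by (induction A rule: infinite_finite_induct) (auto simp: conjg_add)

section \<open>Rank over a field\<close>

lemma rank_eq_ncols_iff: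
  fixes A :: "'k::field^'n^'m"
  shows "rank A = CARD('n) \<longleftrightarrow> (\<forall>x. A *v x = 0 \<longrightarrow> x = 0)"
proof -
  have "rank A = CARD('n) \<longleftrightarrow> vec.span (rows A) = UNIV"
    by (metis row_rank_def_gen vec.dim_eq_full vec_dim_card vec.dim_UNIV vec.dimension_def)
  then show ?thesis
    by (simp add: matrix_left_invertible_span_rows_gen[symmetric] matrix_left_invertible_ker)
qed

lemma rank_transpose_field: "rank (transpose A) = rank (A :: 'k::field^'n^'m)"
  by (metis rank_eq_dim_columns row_rank_def_gen rows_transpose)

lemma rank_eq_nrows_iff:
  fixes A :: "'k::field^'n^'m"
  shows "rank A = CARD('m) \<longleftrightarrow> (\<forall>w. w v* A = 0 \<longrightarrow> w = 0)"
  using rank_eq_ncols_iff[of "transpose A"] by (simp add: rank_transpose_field)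

lemma rank_le_ncols: "rank (A :: 'k::field^'n^'m) \<le> CARD('n)"
  by (simp add: row_rank_def_gen dim_subset_UNIV_cart_gen)

lemma dim_eq_nrows_mono:
  assumes "rank (A :: 'k::field^'n^'m) = CARD('m)" "columns A \<subseteq> S"
  shows "vec.dim S = CARD('m)"
  by (metis assms dim_subset_UNIV_cart_gen le_antisym rank_eq_dim_columns vec.dim_subset)

section \<open>Concatenated matrices\<close>

lemma hcat_mult:
  fixes A :: "'k::semiring_1^'n^'l"
  shows "hcat A B *v x = A *v (\<chi> i. x $ Inl i) + B *v (\<chi> i. x $ Inr i)"
  by (simp add: vec_eq_iff matrix_vector_mult_def hcat_def UNIV_Plus_UNIV[symmetric] sum.Plus
    del: UNIV_Plus_UNIV)

lemma mult_hcat_eq_0_iff: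
  fixes A :: "'k::semiring_1^'n^'l"
  shows "w v* hcat A B = 0 \<longleftrightarrow> w v* A = 0 \<and> w v* B = 0"
proof -
  have "(w v* hcat A B) $ Inl i = (w v* A) $ i" "(w v* hcat A B) $ Inr j = (w v* B) $ j" for i j
    by (simp_all add: vector_matrix_mult_def hcat_def)
  then show ?thesis
    by (metis (no_types, opaque_lifting) sum.exhaust_sel vec_eq_iff zero_index)
qed

definition vcat :: "'a^'n \<Rightarrow> 'a^'m \<Rightarrow> 'a^('n + 'm)" where
  "vcat x u = (\<chi> i. case i of Inl a \<Rightarrow> x $ a | Inr b \<Rightarrow> u $ b)"

lemma hcat_mult_vcat [simp]:
  fixes A :: "'k::semiring_1^'n^'l"
  shows "hcat A B *v vcat x u = A *v x + B *v u"
  by (simp add: hcat_mult vcat_def)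

lemma vcat_split: "x = vcat (\<chi> i. x $ Inl i) (\<chi> i. x $ Inr i)"
  by (auto simp: vcat_def vec_eq_iff split: sum.splits)

lemma vcat_eq_0_iff [simp]: "vcat x u = 0 \<longleftrightarrow> x = 0 \<and> (u :: 'a::zero^'m) = 0"
proof -
  have "(\<forall>i. vcat x u $ i = 0) \<longleftrightarrow> (\<forall>i. x $ i = 0) \<and> (\<forall>j. u $ j = 0)"
    by (subst split_sum_all) (simp add: vcat_def)
  then show ?thesis
    by (simp add: vec_eq_iff)
qed

lemma hcat_inj_iff:
  fixes A :: "'k::semiring_1^'n^'l"
  shows "(\<forall>x. hcat A B *v x = 0 \<longrightarrow> x = 0)
    \<longleftrightarrow> (\<forall>x u. A *v x + B *v u = 0 \<longrightarrow> x = 0 \<and> u = 0)"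
  by (metis hcat_mult_vcat vcat_eq_0_iff vcat_split)

section \<open>Clearing denominators\<close>

lemma common_denominator:
  fixes w :: "'i::finite \<Rightarrow> 'b::idom fract"
  shows "\<exists>c W. c \<noteq> 0 \<and> (\<forall>i. to_fract (W i) = to_fract c * w i)"
proof -
  have "\<exists>p q. q \<noteq> 0 \<and> w i = Fraction_Field.Fract p q" for i
    by (cases "w i") auto
  then obtain p q where pq: "\<And>i. q i \<noteq> 0" "\<And>i. w i = Fraction_Field.Fract (p i) (q i)"
    by metis
  have "to_fract (p i * (\<Prod>j\<in>UNIV - {i}. q j)) = to_fract (\<Prod>j\<in>UNIV. q j) * w i" for i
    by (simp add: pq to_fract_def eq_fract prod.remove[of UNIV i q])
  moreover have "(\<Prod>j\<in>UNIV. q j) \<noteq> 0"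
    by (simp add: pq)
  ultimately show ?thesis
    by (intro exI[of _ "\<Prod>j\<in>UNIV. q j"] exI[of _ "\<lambda>i. p i * (\<Prod>j\<in>UNIV - {i}. q j)"]) blast
qed

lemma to_fract_sum: "to_fract (sum f A) = (\<Sum>x\<in>A. to_fract (f x))"
  by (induction A rule: infinite_finite_induct) auto

text \<open>Clearing denominators makes the entries of a kernel vector polynomials, whose
  coefficients can then be compared degree by degree.\<close>

lemma fract_kernel:
  fixes G :: "'i \<Rightarrow> 'j::finite \<Rightarrow> 'b::idom"
  assumes "\<And>i. (\<Sum>j\<in>UNIV. to_fract (G i j) * w j) = 0" "w \<noteq> (\<lambda>_. 0)"
  obtains W where "W \<noteq> (\<lambda>_. 0)" "\<And>i. (\<Sum>j\<in>UNIV. G i j * W j) = 0"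
proof -
  obtain c W where cW: "c \<noteq> 0" "\<And>i. to_fract (W i) = to_fract c * w i"
    using common_denominator[of w] by blast
  have "to_fract (\<Sum>j\<in>UNIV. G i j * W j) = to_fract c * (\<Sum>j\<in>UNIV. to_fract (G i j) * w j)" for i
    by (simp add: to_fract_sum cW sum_distrib_left algebra_simps)
  then have "(\<Sum>j\<in>UNIV. G i j * W j) = 0" for i
    by (metis assms(1) mult_zero_right to_fract_eq_0_iff)
  moreover have "W \<noteq> (\<lambda>_. 0)"
  proof
    assume "W = (\<lambda>_. 0)"
    then have "to_fract c * w i = 0" for i
      using cW(2)[of i] by simp
    then show False
      using cW(1) assms(2) by auto
  qed
  ultimately show ?thesis
    using that by blast
qed

lemma coeff_sum_linear_poly:
  fixes c d :: "'j \<Rightarrow> 'k::comm_ring_1"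
  shows "coeff (\<Sum>j\<in>S. [:- c j, d j:] * W j) (Suc e)
    = (\<Sum>j\<in>S. d j * coeff (W j) e) - (\<Sum>j\<in>S. c j * coeff (W j) (Suc e))"
  by (simp add: coeff_sum sum_subtractf)

text \<open>Let \<open>W\<close> be a polynomial row annihilating the pencil and \<open>d\<close>
  its largest degree. In degree \<open>d + 1\<close> only the product with \<open>E\<close>
  survives, so the coefficients of degree \<open>d\<close> form a left kernel vector of
  \<open>[E, B]\<close>.\<close>

lemma rank_pencil_rat_nrows:
  fixes E A :: "'k::real_or_complex^'n^'l" and B :: "'k^'m^'l"
  assumes "rank (hcat E B) = CARD('l)"
  shows "rank (pencil_rat E A B) = CARD('l)"
  unfolding rank_eq_nrows_iff
proof (intro allI impI, rule ccontr)
  fix w assume w: "w v* pencil_rat E A B = 0" "w \<noteq> 0"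
  let ?G = "\<lambda>j i. case j of Inl a \<Rightarrow> [:- (A $ i $ a), E $ i $ a:] | Inr b \<Rightarrow> [:B $ i $ b:]"
  have "(\<Sum>i\<in>UNIV. to_fract (?G j i) * w $ i) = (w v* pencil_rat E A B) $ j" for j
    by (cases j) (simp_all add: pencil_rat_def hcat_def vector_matrix_mult_def to_fract_def
        mult.commute[of _ "w $ _"])
  then have 0: "(\<Sum>i\<in>UNIV. to_fract (?G j i) * w $ i) = 0" for j
    using w by simp
  have nz: "($) w \<noteq> (\<lambda>_. 0)"
    using w(2) by (auto simp: vec_eq_iff fun_eq_iff)
  obtain W where W: "W \<noteq> (\<lambda>_. 0)" "\<And>j. (\<Sum>i\<in>UNIV. ?G j i * W i) = 0"
    by (rule fract_kernel[of ?G "($) w", OF 0 nz]) (rule that)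
  define d where "d = Max (degree ` range W)"
  have le: "degree (W i) \<le> d" for i
    by (simp add: d_def)
  have WE: "(\<Sum>i\<in>UNIV. [:- (A $ i $ a), E $ i $ a:] * W i) = 0" for a
    using W(2)[of "Inl a"] by simp
  have WB: "(\<Sum>i\<in>UNIV. [:B $ i $ b:] * W i) = 0" for b
    using W(2)[of "Inr b"] by simp
  define v where "v = (\<chi> i. coeff (W i) d)"
  have "(v v* E) $ a = 0" for a
  proof -
    have "(\<Sum>i\<in>UNIV. E $ i $ a * coeff (W i) d)
        - (\<Sum>i\<in>UNIV. A $ i $ a * coeff (W i) (Suc d)) = 0"
      using coeff_sum_linear_poly[where S=UNIV and e=d and W=W and c="\<lambda>i. A $ i $ a" and d="\<lambda>i. E $ i $ a"]
      by (simp only: WE coeff_0)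
    moreover have "coeff (W i) (Suc d) = 0" for i
      using le[of i] by (intro coeff_eq_0) simp
    ultimately show ?thesis
      by (simp add: vector_matrix_mult_def v_def mult.commute)
  qed
  moreover have "(v v* B) $ b = 0" for b
    using arg_cong[OF WB[of b], of "\<lambda>p. coeff p d"]
    by (simp add: vector_matrix_mult_def v_def mult.commute coeff_sum)
  ultimately have "v v* hcat E B = 0"
    by (subst mult_hcat_eq_0_iff) (auto simp: vec_eq_iff)
  then have v: "v = 0"
    using assms rank_eq_nrows_iff by blast
  have "d \<in> degree ` range W"
    unfolding d_def by (intro Max_in) auto
  then obtain i where "degree (W i) = d"
    by auto
  then have "W i = 0"
    using v by (auto simp: v_def vec_eq_iff dest: spec[of _ i])
  then have "d = 0"
    using \<open>degree (W i) = d\<close> by simp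
  have "W = (\<lambda>_. 0)"
  proof
    fix j
    have "degree (W j) = 0" "coeff (W j) 0 = 0"
      using le[of j] v \<open>d = 0\<close> by (auto simp: v_def vec_eq_iff)
    then show "W j = 0"
      by (metis leading_coeff_0_iff)
  qed
  then show False
    using W(1) by simp
qed

text \<open>The factor x in front of \<open>E\<close> shifts the two blocks of a polynomial column
  against each other: the coefficients satisfy \<open>E x(e) + B u(e+1) = A x(e+1)\<close>.
  Injectivity of \<open>[E, B]\<close> therefore carries zeros downwards from above the
  degree.\<close>

lemma rank_pencil_rat_ncols:
  fixes E A :: "'k::real_or_complex^'n^'l" and B :: "'k^'m^'l"
  assumes "rank (hcat E B) = CARD('n) + CARD('m)"
  shows "rank (pencil_rat E A B) = CARD('n) + CARD('m)"
proof -
  have inj: "x = 0 \<and> u = 0" if "E *v x + B *v u = 0" for x u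
    using assms rank_eq_ncols_iff[of "hcat E B"] that by (simp add: hcat_inj_iff)
  have "\<forall>w. pencil_rat E A B *v w = 0 \<longrightarrow> w = 0"
  proof (intro allI impI, rule ccontr)
    fix w assume w: "pencil_rat E A B *v w = 0" "w \<noteq> 0"
    let ?G = "\<lambda>i j. case j of Inl a \<Rightarrow> [:- (A $ i $ a), E $ i $ a:] | Inr b \<Rightarrow> [:B $ i $ b:]"
    have "to_fract (?G i j) = pencil_rat E A B $ i $ j" for i j
      by (cases j) (simp_all add: pencil_rat_def hcat_def to_fract_def)
    then have 0: "(\<Sum>j\<in>UNIV. to_fract (?G i j) * w $ j) = 0" for i
      using w by (simp add: matrix_vector_mult_def vec_eq_iff)
    have nz: "($) w \<noteq> (\<lambda>_. 0)"
      using w(2) by (auto simp: vec_eq_iff fun_eq_iff)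
    obtain W where W: "W \<noteq> (\<lambda>_. 0)" "\<And>i. (\<Sum>j\<in>UNIV. ?G i j * W j) = 0"
      by (rule fract_kernel[of ?G "($) w", OF 0 nz]) (rule that)
    have W': "(\<Sum>a\<in>UNIV. [:- (A $ i $ a), E $ i $ a:] * W (Inl a))
        + (\<Sum>b\<in>UNIV. [:B $ i $ b:] * W (Inr b)) = 0" for i
      using W(2)[of i] by (simp add: UNIV_Plus_UNIV[symmetric] sum.Plus del: UNIV_Plus_UNIV)
    define x where "x e = (\<chi> a. coeff (W (Inl a)) e)" for e
    define u where "u e = (\<chi> b. coeff (W (Inr b)) e)" for e
    have rec: "E *v x e + B *v u (Suc e) = A *v x (Suc e)" for e
    proof -
      have "(E *v x e - A *v x (Suc e) + B *v u (Suc e)) $ i = 0" for i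
        using arg_cong[OF W'[of i], of "\<lambda>p. coeff p (Suc e)"] coeff_add
          coeff_sum_linear_poly[where S=UNIV and e=e and W="\<lambda>a. W (Inl a)"
            and c="\<lambda>a. A $ i $ a" and d="\<lambda>a. E $ i $ a"]
        by (simp add: matrix_vector_mult_def x_def u_def coeff_sum del: mult_pCons_left)
           (simp add: matrix_vector_mult_def x_def u_def coeff_sum)
      then have "E *v x e - A *v x (Suc e) + B *v u (Suc e) = 0"
        by (simp only: vec_eq_iff zero_index) blast
      then show ?thesis
        by (simp add: diff_add_eq)
    qed
    \<comment> \<open>The successor lies above all degrees, so the descent starts at a zero
      coefficient.\<close>
    define d where "d = Suc (Max (degree ` range W))"
    have "degree (W j) < d" for j
      by (simp add: d_def less_Suc_eq_le)
    then have x_top: "x d = 0"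
      by (simp add: x_def vec_eq_iff coeff_eq_0)
    have step: "x e = 0 \<and> u (Suc e) = 0" if "x (Suc e) = 0" for e
      using rec[of e] that inj by simp
    have "x (d - k) = 0" for k
    proof (induction k)
      case (Suc k)
      then show ?case
        using step[of "d - Suc k"] by (cases "k < d") (auto simp: Suc_diff_Suc)
    qed (use x_top in simp)
    then have x_le: "x e = 0" if "e \<le> d" for e
      by (metis that diff_diff_cancel)
    have x: "x e = 0" for e
    proof (cases "e \<le> d")
      case False
      then show ?thesis
        using \<open>\<And>j. degree (W j) < d\<close>
        by (simp add: x_def vec_eq_iff) (metis coeff_eq_0 less_trans not_le)
    qed (use x_le in simp)
    have "(B *v u 0) $ i = 0" for i
      using arg_cong[OF W'[of i], of "\<lambda>p. coeff p 0"] x[of 0]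
      by (simp add: matrix_vector_mult_def x_def u_def coeff_sum vec_eq_iff)
    then have "u 0 = 0"
      using inj[of 0 "u 0"] by (simp add: vec_eq_iff)
    then have u: "u e = 0" for e
      using step[of "e - 1"] x by (cases e) auto
    have "W j = 0" for j
    proof (cases j)
      case (Inl a)
      then show ?thesis
        using x by (auto simp: x_def vec_eq_iff poly_eq_iff)
    next
      case (Inr b)
      then show ?thesis
        using u by (auto simp: u_def vec_eq_iff poly_eq_iff)
    qed
    then show False
      using W(1) by auto
  qed
  then show ?thesis
    using rank_eq_ncols_iff[of "pencil_rat E A B"] by simp
qed

section \<open>Polynomial functions and genericity\<close>

text \<open>Determinants of complexified matrices are complex, while algebraic sets are cut out by
  real polynomials in real coordinates.\<close>

definition complex_polynomial_function :: "('a::real_normed_vector \<Rightarrow> complex) \<Rightarrow> bool" where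
  "complex_polynomial_function f \<longleftrightarrow>
     real_polynomial_function (\<lambda>x. Re (f x)) \<and> real_polynomial_function (\<lambda>x. Im (f x))"

lemma complex_polynomial_function_const [intro]: "complex_polynomial_function (\<lambda>x. c)"
  by (auto simp: complex_polynomial_function_def intro: real_polynomial_function.intros)

lemma complex_polynomial_function_add [intro]:
  assumes "complex_polynomial_function f" "complex_polynomial_function g"
  shows "complex_polynomial_function (\<lambda>x. f x + g x)"
  using assms
  by (auto simp: complex_polynomial_function_def intro: real_polynomial_function.intros)

lemma complex_polynomial_function_mult [intro]:
  assumes "complex_polynomial_function f" "complex_polynomial_function g"
  shows "complex_polynomial_function (\<lambda>x. f x * g x)"
  using assms
  by (auto simp: complex_polynomial_function_def
      intro!: real_polynomial_function.intros(2-4) real_polynomial_function_diff)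

lemma complex_polynomial_function_diff [intro]:
  assumes "complex_polynomial_function f" "complex_polynomial_function g"
  shows "complex_polynomial_function (\<lambda>x. f x - g x)"
  using assms by (auto simp: complex_polynomial_function_def)

lemma complex_polynomial_function_sum [intro]:
  assumes "\<And>i. i \<in> I \<Longrightarrow> complex_polynomial_function (f i)"
  shows "complex_polynomial_function (\<lambda>x. \<Sum>i\<in>I. f i x)"
  using assms by (induction I rule: infinite_finite_induct) auto

lemma complex_polynomial_function_prod [intro]:
  assumes "\<And>i. i \<in> I \<Longrightarrow> complex_polynomial_function (f i)"
  shows "complex_polynomial_function (\<lambda>x. \<Prod>i\<in>I. f i x)"
  using assms by (induction I rule: infinite_finite_induct) auto

lemma complex_polynomial_function_det:
  assumes "\<And>i j. complex_polynomial_function (\<lambda>x. G x $ i $ j)"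
  shows "complex_polynomial_function (\<lambda>x. det (G x))"
  unfolding det_def using assms by (intro complex_polynomial_function_sum
      complex_polynomial_function_mult complex_polynomial_function_prod) auto

lemma complex_polynomial_function_to_complex:
  fixes f :: "'a::euclidean_space \<Rightarrow> 'k::real_or_complex"
  assumes "linear f"
  shows "complex_polynomial_function (\<lambda>x. to_complex (f x))"
proof -
  have "linear (\<lambda>x. to_complex (f x))"
    using linear_compose[OF assms linear_to_complex] by (simp add: o_def)
  then have "bounded_linear (\<lambda>x. to_complex (f x))"
    by (simp add: linear_conv_bounded_linear)
  then show ?thesis
    by (auto simp: complex_polynomial_function_def bounded_linear_compose[OF bounded_linear_Re]
        bounded_linear_compose[OF bounded_linear_Im] intro!: real_polynomial_function.intros(1))
qed

text \<open>The parameter 1 is excluded because the target \<open>x0\<close> may lie outside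
  \<open>V\<close>: for \<open>Sigma_dH\<close> it has \<open>R = 0\<close>. Paths are polynomial
  and not just straight since \<open>Q = M E\<close> moves as a product of two segments.\<close>

definition poly_joined :: "'a::real_normed_vector set \<Rightarrow> 'a \<Rightarrow> 'a set" where
  "poly_joined V x0 =
     {w. \<exists>\<gamma>. polynomial_function \<gamma> \<and> \<gamma> 0 = w \<and> \<gamma> 1 = x0 \<and> (\<forall>t\<in>{0..<1::real}. \<gamma> t \<in> V)}"

lemma poly_joined_in_closure:
  fixes p :: "'a::euclidean_space \<Rightarrow> real"
  assumes "real_polynomial_function p" "p x0 \<noteq> 0" "w \<in> poly_joined V x0"
  shows "w \<in> closure ({x. p x \<noteq> 0} \<inter> V)"
  unfolding closure_approachable
proof (intro allI impI)
  fix e :: real assume "e > 0"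
  obtain \<gamma> where \<gamma>: "polynomial_function \<gamma>" "\<gamma> 0 = w" "\<gamma> 1 = x0"
      "\<And>t. t \<in> {0..<1::real} \<Longrightarrow> \<gamma> t \<in> V"
    using assms(3) unfolding poly_joined_def by blast
  have "real_polynomial_function (p \<circ> \<gamma>)"
    using assms(1) \<gamma>(1) by blast
  then obtain a n where an: "p \<circ> \<gamma> = (\<lambda>t. \<Sum>i\<le>n. a i * t ^ i)"
    using real_polynomial_function_iff_sum by blast
  define P where "P = (\<Sum>i\<le>n. monom (a i) i)"
  have P: "poly P t = p (\<gamma> t)" for t
    using fun_cong[OF an, of t] by (simp add: P_def poly_sum poly_monom)
  then have "P \<noteq> 0"
    using assms(2) \<gamma>(3) by (metis poly_0)
  then have fin: "finite {t. poly P t = 0}"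
    by (rule poly_roots_finite)
  have "isCont \<gamma> 0"
    using \<gamma>(1) continuous_polymonial_function by blast
  then obtain d where d: "d > 0" "\<And>t. dist t 0 < d \<Longrightarrow> dist (\<gamma> t) (\<gamma> 0) < e"
    using \<open>e > 0\<close> unfolding continuous_at_eps_delta by blast
  have "infinite {0<..<min d 1}"
    using d(1) by simp
  then obtain t where t: "t \<in> {0<..<min d 1}" "poly P t \<noteq> 0"
    using fin by (metis (mono_tags, lifting) finite_subset mem_Collect_eq subsetI)
  then have "\<gamma> t \<in> {x. p x \<noteq> 0} \<inter> V" "dist (\<gamma> t) w < e"
    using P[of t] \<gamma>(2) \<gamma>(4)[of t] d(2)[of t] by auto
  then show "\<exists>y\<in>{x. p x \<noteq> 0} \<inter> V. dist y w < e"
    by blast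
qed

text \<open>A left inverse \<open>H\<close> of \<open>G x0\<close> replaces a search through maximal
  minors: \<open>det (H ** G x)\<close> is a single polynomial that equals 1 at \<open>x0\<close>
  and vanishes wherever \<open>G x\<close> fails to be injective.\<close>

lemma relative_generic_injective:
  fixes G :: "'a::euclidean_space \<Rightarrow> complex^'c^'r"
  assumes poly: "\<And>i j. complex_polynomial_function (\<lambda>x. G x $ i $ j)"
    and inj: "\<And>v. G x0 *v v = 0 \<Longrightarrow> v = 0"
    and dense: "V \<subseteq> closure (poly_joined V x0)"
    and S: "\<And>x. x \<in> V \<Longrightarrow> (\<forall>v. G x *v v = 0 \<longrightarrow> v = 0) \<Longrightarrow> x \<in> S"
  shows "relative_generic S V"
proof -
  obtain H where H: "H ** G x0 = mat 1"
    using matrix_left_invertible_ker[of "G x0"] inj by blast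
  define D where "D x = det (H ** G x)" for x
  have D: "complex_polynomial_function D"
    unfolding D_def[abs_def] matrix_matrix_mult_def
    by (rule complex_polynomial_function_det, unfold vec_lambda_beta)
       (intro complex_polynomial_function_sum complex_polynomial_function_mult
         complex_polynomial_function_const poly)
  \<comment> \<open>The squared modulus turns the complex polynomial into one real polynomial with
    the same zeros.\<close>
  define p where "p x = (Re (D x))\<^sup>2 + (Im (D x))\<^sup>2" for x
  have p: "real_polynomial_function p"
    using D unfolding p_def[abs_def] complex_polynomial_function_def
    by (auto intro!: real_polynomial_function.intros(2-4) real_polynomial_function_power)
  have p0: "p x \<noteq> 0 \<longleftrightarrow> D x \<noteq> 0" for x
    by (simp add: p_def complex_eq_iff sum_power2_eq_zero_iff)
  define \<V> where "\<V> = {x. p x = 0}"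
  have "algebraic_set \<V>"
    unfolding algebraic_set_def \<V>_def using p by (intro exI[of _ "{p}"]) auto
  moreover have "- S \<inter> V \<subseteq> \<V> \<inter> V"
  proof safe
    fix x assume "x \<in> V" "x \<notin> S"
    then obtain v where v: "G x *v v = 0" "v \<noteq> 0"
      using S by blast
    then have "(H ** G x) *v v = 0"
      by (simp add: matrix_vector_mul_assoc[symmetric])
    then have "D x = 0"
      using v(2) unfolding D_def
      by (metis invertible_det_nz invertible_left_inverse matrix_left_invertible_ker)
    then show "x \<in> \<V>"
      using p0 by (auto simp: \<V>_def)
  qed
  moreover have "V \<subseteq> closure (- \<V> \<inter> V)"
  proof -
    have "p x0 \<noteq> 0"
      by (simp add: p0 D_def H)
    then have "poly_joined V x0 \<subseteq> closure ({x. p x \<noteq> 0} \<inter> V)"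
      using poly_joined_in_closure p by blast
    then have "closure (poly_joined V x0) \<subseteq> closure ({x. p x \<noteq> 0} \<inter> V)"
      by (rule closure_minimal[OF _ closed_closure])
    moreover have "- \<V> = {x. p x \<noteq> 0}"
      by (auto simp: \<V>_def)
    ultimately show ?thesis
      using dense by simp
  qed
  ultimately show ?thesis
    unfolding relative_generic_def by blast
qed

section \<open>Genericity of a set excludes genericity of its complement\<close>

lemma closed_algebraic_set:
  assumes "algebraic_set \<V>"
  shows "closed \<V>"
proof -
  obtain P where P: "\<And>p. p \<in> P \<Longrightarrow> real_polynomial_function p" "\<V> = {x. \<forall>p\<in>P. p x = 0}"
    using assms unfolding algebraic_set_def by blast
  have "\<V> = (\<Inter>p\<in>P. {x. p x = 0})"
    using P(2) by auto
  moreover have "closed {x. p x = 0}" if "p \<in> P" for p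
    using P(1)[OF that] continuous_on_polymonial_function[of p UNIV]
    by (intro closed_Collect_eq continuous_on_const) (simp_all add: real_polynomial_function_eq)
  ultimately show ?thesis
    by (metis (no_types, lifting) closed_INT)
qed

text \<open>The two exceptional sets would cover \<open>V\<close>. But the complement of one is open
  and meets \<open>V\<close>, so it contains points of the complement of the other, which is dense
  in \<open>V\<close>.\<close>

lemma not_relative_generic_both:
  assumes "relative_generic S V" "V \<noteq> {}"
  shows "\<not> relative_generic (- S) V"
proof
  assume "relative_generic (- S) V"
  then obtain \<V> where \<V>: "algebraic_set \<V>" "S \<inter> V \<subseteq> \<V>" "V \<subseteq> closure (- \<V> \<inter> V)"
    unfolding relative_generic_def by auto
  obtain \<W> where \<W>: "- S \<inter> V \<subseteq> \<W>" "V \<subseteq> closure (- \<W> \<inter> V)"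
    using assms(1) unfolding relative_generic_def by auto
  obtain x where x: "x \<in> V" "x \<notin> \<V>"
    using \<V>(3) assms(2) by (metis IntE closure_eq_empty Compl_iff ex_in_conv subset_empty)
  have "open (- \<V>)"
    using closed_algebraic_set[OF \<V>(1)] by (rule open_Compl)
  moreover have "x \<in> - \<V> \<inter> closure (- \<W> \<inter> V)"
    using x \<W>(2) by auto
  ultimately have "- \<V> \<inter> (- \<W> \<inter> V) \<noteq> {}"
    by (metis empty_iff open_Int_closure_eq_empty)
  then show False
    using \<V>(2) \<W>(1) by auto
qed

text \<open>Each equivalence and each claim on complements thus reduces to two genericity proofs,
  one per case of the dimension condition.\<close>

lemma generic_dichotomy:
  assumes "V \<noteq> {}" "c \<Longrightarrow> relative_generic S V" "\<not> c \<Longrightarrow> relative_generic (- S) V"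
  shows "relative_generic S V \<longleftrightarrow> c"
    and "\<not> relative_generic S V \<longrightarrow> relative_generic (- S) V"
  using assms not_relative_generic_both[of S V] by blast+

section \<open>Adjoints and quadratic forms\<close>

lemma adj_adj [simp]: "adj (adj M) = M"
  by (simp add: adj_def vec_eq_iff)

lemma adj_0 [simp]: "adj 0 = 0"
  by (simp add: adj_def vec_eq_iff)

lemma adj_add: "adj (M + N) = adj M + adj N"
  by (simp add: adj_def vec_eq_iff conjg_add)

lemma adj_minus [simp]: "adj (- M) = - adj M"
  by (simp add: adj_def vec_eq_iff)

lemma adj_scaleR: "adj (r *\<^sub>R M) = r *\<^sub>R adj M"
  by (simp add: adj_def vec_eq_iff conjg_scaleR)

lemma adj_mat_1 [simp]: "adj (mat 1) = mat 1"
  by (simp add: adj_def vec_eq_iff mat_def if_distrib cong: if_cong)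

lemma adj_mult: "adj (A ** B) = adj B ** adj A"
  by (simp add: adj_def vec_eq_iff matrix_matrix_mult_def conjg_sum conjg_mult mult.commute)

lemma matrix_mult_add_left: "(A + B) ** C = A ** C + B ** (C :: 'k::semiring_1^'p^'n)"
  by (simp add: vec_eq_iff matrix_matrix_mult_def distrib_right sum.distrib)

lemma scaleR_matrix_mult: "(r *\<^sub>R A) ** B = r *\<^sub>R (A ** (B :: 'k::real_normed_field^'p^'n))"
  by (simp add: vec_eq_iff matrix_matrix_mult_def scaleR_sum_right)

lemma matrix_mult_scaleR: "A ** (r *\<^sub>R B) = r *\<^sub>R (A ** (B :: 'k::real_normed_field^'p^'n))"
  by (simp add: vec_eq_iff matrix_matrix_mult_def scaleR_sum_right)

lemma scaleR_matrix_vector_mult: "(r *\<^sub>R A) *v x = r *\<^sub>R (A *v (x :: 'k::real_normed_field^'n))"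
  by (simp add: vec_eq_iff matrix_vector_mult_def scaleR_sum_right)

text \<open>The Hermitian form for which \<open>adj\<close> is the adjoint, conjugate linear in its
  first argument.\<close>

definition hdot :: "'k::real_or_complex^'n \<Rightarrow> 'k^'n \<Rightarrow> 'k" where
  "hdot x y = (\<Sum>i\<in>UNIV. conjg (x $ i) * y $ i)"

lemma quad_form_hdot: "quad_form M x = hdot x (M *v x)"
  by (simp add: quad_form_def hdot_def)

lemma hdot_add_right: "hdot x (y + z) = hdot x y + hdot x z"
  by (simp add: hdot_def distrib_left sum.distrib)

lemma hdot_scaleR_right: "hdot x (r *\<^sub>R y) = r *\<^sub>R hdot x y"
  by (simp add: hdot_def scaleR_sum_right)

lemma hdot_adj: "hdot x (adj A *v y) = hdot (A *v x) y"
proof -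
  have "hdot x (adj A *v y) = (\<Sum>i\<in>UNIV. \<Sum>j\<in>UNIV. conjg (x $ i) * (conjg (A $ j $ i) * y $ j))"
    by (simp add: hdot_def adj_def matrix_vector_mult_def sum_distrib_left)
  also have "\<dots> = (\<Sum>j\<in>UNIV. \<Sum>i\<in>UNIV. conjg (x $ i) * (conjg (A $ j $ i) * y $ j))"
    by (rule sum.swap)
  also have "\<dots> = hdot (A *v x) y"
    by (simp add: hdot_def matrix_vector_mult_def sum_distrib_right sum_distrib_left conjg_sum
        conjg_mult mult_ac)
  finally show ?thesis .
qed

abbreviation re :: "'k::real_or_complex \<Rightarrow> real" where
  "re x \<equiv> Re (to_complex x)"

lemma re_hdot_self: "re (hdot x x) = (norm x)\<^sup>2"
proof -
  have "re (conjg z * z) = (norm z)\<^sup>2" for z :: 'a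
    using cmod_power2[of "to_complex z"]
    by (simp add: to_complex_mult to_complex_conjg norm_to_complex power2_eq_square)
  then show ?thesis
    by (simp add: hdot_def to_complex_sum norm_vec_def L2_set_def sum_nonneg)
qed

text \<open>Young's inequality. The weight \<open>d\<close> is free so that the
  \<open>norm y\<close> term can later be matched with a regularisation term.\<close>

lemma re_hdot_le:
  assumes "d > 0"
  shows "re (hdot y x) \<le> d * (norm y)\<^sup>2 + (norm x)\<^sup>2 / (4 * d)"
proof -
  have 1: "re (conjg a * b) \<le> d * (norm a)\<^sup>2 + (norm b)\<^sup>2 / (4 * d)" for a b :: 'a
  proof -
    have "re (conjg a * b) \<le> norm (conjg a * b)"
      by (metis complex_Re_le_cmod norm_to_complex)
    also have "\<dots> = norm a * norm b"
      by (metis complex_mod_cnj norm_mult norm_to_complex to_complex_conjg)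
    also have "\<dots> \<le> d * (norm a)\<^sup>2 + (norm b)\<^sup>2 / (4 * d)"
      using assms zero_le_power2[of "2 * d * norm a - norm b"]
      by (simp add: field_simps power2_eq_square)
    finally show ?thesis .
  qed
  have "re (hdot y x) \<le> (\<Sum>i\<in>UNIV. d * (norm (y $ i))\<^sup>2 + (norm (x $ i))\<^sup>2 / (4 * d))"
    unfolding hdot_def to_complex_sum Re_sum by (intro sum_mono 1)
  also have "\<dots> = d * (norm y)\<^sup>2 + (norm x)\<^sup>2 / (4 * d)"
    by (simp add: sum.distrib norm_vec_def L2_set_def sum_nonneg sum_distrib_left sum_divide_distrib)
  finally show ?thesis .
qed

lemma re_quad_form_add:
  "re (quad_form (r *\<^sub>R M + s *\<^sub>R N) x) = r * re (quad_form M x) + s * re (quad_form N x)"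
  by (simp add: quad_form_hdot matrix_vector_mult_add_rdistrib scaleR_matrix_vector_mult
      hdot_add_right hdot_scaleR_right to_complex_add to_complex_scaleR)

lemma pos_semidef_combine:
  assumes "pos_semidef M" "pos_semidef N" "r \<ge> 0" "s \<ge> 0"
  shows "pos_semidef (r *\<^sub>R M + s *\<^sub>R N)"
  using assms by (auto simp: pos_semidef_def re_quad_form_add adj_add adj_scaleR)

lemma pos_semidef_congruence:
  assumes "pos_semidef M"
  shows "pos_semidef (adj E ** M ** E)"
proof -
  have "quad_form (adj E ** M ** E) x = quad_form M (E *v x)" for x
    by (simp add: quad_form_hdot hdot_adj flip: matrix_vector_mul_assoc)
  then show ?thesis
    using assms by (auto simp: pos_semidef_def adj_mult matrix_mul_assoc)
qed

lemma pos_semidef_0 [simp]: "pos_semidef 0"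
  by (simp add: pos_semidef_def quad_form_hdot hdot_def)

lemma re_quad_form_mat_1: "re (quad_form (mat 1) x) = (norm x)\<^sup>2"
  by (simp add: quad_form_hdot re_hdot_self)

lemma pos_def_mat_1 [simp]: "pos_def (mat 1)"
  by (simp add: pos_def_def re_quad_form_mat_1)

lemma pos_def_imp_pos_semidef: "pos_def M \<Longrightarrow> pos_semidef M"
  unfolding pos_def_def pos_semidef_def
  by (metis (no_types, lifting) hdot_def less_eq_real_def matrix_vector_mult_0_right mult_zero_right
      quad_form_hdot sum.neutral to_complex_0 zero_complex.sel(1) zero_index)

section \<open>Density of the pairs with \<open>Q = M E\<close>\<close>

text \<open>If \<open>T = adj Q ** (E + e Q)\<close> were invertible,
  \<open>M = Q T^(-1) adj Q\<close> would give \<open>M (E + e Q) = Q\<close> exactly. Adding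
  \<open>e ^ 3\<close> times the identity makes \<open>T\<close> positive definite and leaves the
  error \<open>e ^ 3 Q T^(-1)\<close>.\<close>

lemma scaled_pair_approx:
  fixes E Q :: "'k::real_or_complex^'n^'l"
  assumes EQ: "adj E ** Q = adj Q ** E" "pos_semidef (adj E ** Q)" and e: "e > 0"
  shows "\<exists>M. pos_semidef M \<and> (\<forall>i j. norm ((Q - M ** (E + e *\<^sub>R Q)) $ i $ j) \<le> e)"
proof -
  \<comment> \<open>The exponent 3: since \<open>T\<close> dominates
    \<open>e (adj Q ** Q) + e ^ 3\<close>, the columns of \<open>Q T^(-1)\<close> have norm at most
    \<open>1 / (2 e ^ 2)\<close>, and the error is at most \<open>e / 2\<close>.\<close>
  define T where "T = adj Q ** E + e *\<^sub>R (adj Q ** Q) + (e ^ 3) *\<^sub>R mat 1"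
  have T_adj: "adj T = T"
    using EQ(1) by (simp add: T_def adj_add adj_scaleR adj_mult)
  have quad: "re (hdot y (T *v y)) \<ge> e * (norm (Q *v y))\<^sup>2 + e ^ 3 * (norm y)\<^sup>2" for y
  proof -
    have "re (hdot y (adj Q ** E *v y)) \<ge> 0"
      using EQ unfolding pos_semidef_def quad_form_hdot by metis
    \<comment> \<open>Semidefiniteness of \<open>adj Q ** E = adj E ** Q\<close> keeps this term
      from cancelling the other two.\<close>
    moreover have "re (hdot y (adj Q ** Q *v y)) = (norm (Q *v y))\<^sup>2"
      by (simp add: hdot_adj re_hdot_self flip: matrix_vector_mul_assoc)
    ultimately show ?thesis
      by (simp add: T_def matrix_vector_mult_add_rdistrib scaleR_matrix_vector_mult
          hdot_add_right hdot_scaleR_right to_complex_add to_complex_scaleR re_hdot_self)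
  qed
  have "y = 0" if "T *v y = 0" for y
  proof -
    have "e ^ 3 * (norm y)\<^sup>2 \<le> 0"
      using quad[of y] that e by (simp add: hdot_def) (smt (verit) mult_nonneg_nonneg zero_le_power2)
    then show ?thesis
      using e by (simp add: mult_le_0_iff)
  qed
  then obtain X where X: "X ** T = mat 1"
    using matrix_left_invertible_ker by blast
  then have X': "T ** X = mat 1"
    by (simp add: matrix_left_right_inverse)
  have X_adj: "adj X = X"
  proof -
    have "adj X = adj X ** (T ** X)"
      by (simp add: X')
    also have "\<dots> = adj (T ** X) ** X"
      by (simp add: adj_mult T_adj matrix_mul_assoc)
    finally show ?thesis
      by (simp add: X')
  qed
  have TX: "T *v (X *v u) = u" for u
    by (simp add: matrix_vector_mul_assoc X')
  have pos_X: "re (quad_form X u) \<ge> 0" for u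
  proof -
    have "hdot u (X *v u) = hdot (T *v (X *v u)) (X *v u)"
      by (simp add: TX)
    also have "\<dots> = hdot (X *v u) (T *v (X *v u))"
      by (metis T_adj hdot_adj)
    finally show ?thesis
      using quad[of "X *v u"] e
      by (simp add: quad_form_hdot) (smt (verit) mult_nonneg_nonneg zero_le_power zero_le_power2)
  qed
  define M where "M = Q ** X ** adj Q"
  have "pos_semidef X"
    using pos_X X_adj by (simp add: pos_semidef_def)
  then have "pos_semidef M"
    using pos_semidef_congruence[of X "adj Q"] by (simp add: M_def)
  moreover have "norm ((Q - M ** (E + e *\<^sub>R Q)) $ i $ j) \<le> e" for i j
  proof -
    \<comment> \<open>Column \<open>j\<close> of the inverse of \<open>T\<close>;
      \<open>Q *v y\<close> is then column \<open>j\<close> of the error up to the factor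
      \<open>e ^ 3\<close>.\<close>
    define y where "y = X *v axis j 1"
    have "M ** (E + e *\<^sub>R Q) = Q ** X ** (T - (e ^ 3) *\<^sub>R mat 1)"
      by (simp add: M_def T_def matrix_add_ldistrib matrix_mult_scaleR flip: matrix_mul_assoc)
    also have "\<dots> = Q ** X ** T - (e ^ 3) *\<^sub>R (Q ** X)"
    proof -
      have "Q ** X ** (T - (e ^ 3) *\<^sub>R mat 1) + (e ^ 3) *\<^sub>R (Q ** X) = Q ** X ** T"
        using matrix_add_ldistrib[of "Q ** X" "T - (e ^ 3) *\<^sub>R mat 1" "(e ^ 3) *\<^sub>R mat 1"]
        by (simp add: matrix_mult_scaleR)
      then show ?thesis
        by (simp add: eq_diff_eq)
    qed
    also have "Q ** X ** T = Q"
      by (simp add: X flip: matrix_mul_assoc)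
    finally have "Q - M ** (E + e *\<^sub>R Q) = (e ^ 3) *\<^sub>R (Q ** X)"
      by simp
    moreover have "(Q ** X) $ i $ j = (Q *v y) $ i"
      by (simp add: y_def matrix_vector_mul_assoc) (simp add: matrix_vector_mult_def axis_def if_distrib cong: if_cong)
    ultimately have "norm ((Q - M ** (E + e *\<^sub>R Q)) $ i $ j) = e ^ 3 * norm ((Q *v y) $ i)"
      using e by simp
    also have "\<dots> \<le> e ^ 3 * norm (Q *v y)"
      using e by (intro mult_left_mono Finite_Cartesian_Product.norm_nth_le) auto
    also have "\<dots> \<le> e"
    proof -
      have "e * (norm (Q *v y))\<^sup>2 + e ^ 3 * (norm y)\<^sup>2 \<le> re (hdot y (axis j 1))"
        using quad[of y] by (simp add: y_def TX)
      \<comment> \<open>The weight \<open>e ^ 3\<close> lets the \<open>norm y\<close> terms on both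
        sides cancel.\<close>
      also have "\<dots> \<le> e ^ 3 * (norm y)\<^sup>2 + (norm (axis j (1 :: 'k) :: 'k^'n))\<^sup>2 / (4 * e ^ 3)"
        using e by (intro re_hdot_le) simp
      finally have "e * (norm (Q *v y))\<^sup>2 \<le> 1 / (4 * e ^ 3)"
        by (simp add: norm_vec_def L2_set_def axis_def if_distrib[of norm]
            if_distrib[of "\<lambda>r. r\<^sup>2"] cong: if_cong)
      then have "4 * e ^ 4 * (norm (Q *v y))\<^sup>2 \<le> 1"
        using e by (simp add: field_simps eval_nat_numeral)
      then have "(2 * e\<^sup>2 * norm (Q *v y))\<^sup>2 \<le> 1\<^sup>2"
        by (simp add: power_mult_distrib flip: power_mult)
      then have "2 * e\<^sup>2 * norm (Q *v y) \<le> 1"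
        by (rule power2_le_imp_le) simp
      then have "e * (2 * e\<^sup>2 * norm (Q *v y)) \<le> e * 1"
        using e by (intro mult_left_mono) auto
      then have "2 * (e ^ 3 * norm (Q *v y)) \<le> e"
        by (simp add: eval_nat_numeral mult_ac)
      moreover have "0 \<le> e ^ 3 * norm (Q *v y)"
        using e by simp
      ultimately show ?thesis
        by linarith
    qed
    finally show ?thesis .
  qed
  ultimately show ?thesis
    by blast
qed

lemma pair_approx:
  fixes E Q :: "'k::real_or_complex^'n^'l"
  assumes EQ: "adj E ** Q = adj Q ** E" "pos_semidef (adj E ** Q)"
  obtains M F where "\<And>k. pos_semidef (M k)" "F \<longlonglongrightarrow> E" "(\<lambda>k. M k ** F k) \<longlonglongrightarrow> Q"
proof -
  define e where "e k = inverse (real (Suc k))" for k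
  have e: "e \<longlonglongrightarrow> 0"
    unfolding e_def[abs_def] by (rule LIMSEQ_inverse_real_of_nat)
  have pos: "e k > 0" for k
    by (simp add: e_def)
  have "\<forall>k. \<exists>M. pos_semidef M \<and> (\<forall>i j. norm ((Q - M ** (E + e k *\<^sub>R Q)) $ i $ j) \<le> e k)"
    by (intro allI scaled_pair_approx EQ pos)
  from choice[OF this] obtain M where M: "\<And>k. pos_semidef (M k)"
      "\<And>k i j. norm ((Q - M k ** (E + e k *\<^sub>R Q)) $ i $ j) \<le> e k"
    by blast
  have "(\<lambda>k. E + e k *\<^sub>R Q) \<longlonglongrightarrow> E + 0 *\<^sub>R Q"
    by (intro tendsto_intros e)
  moreover have "(\<lambda>k. Q - M k ** (E + e k *\<^sub>R Q)) \<longlonglongrightarrow> 0"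
  proof (intro vec_tendstoI)
    fix i j
    show "(\<lambda>k. (Q - M k ** (E + e k *\<^sub>R Q)) $ i $ j) \<longlonglongrightarrow> 0 $ i $ j"
      unfolding zero_index using M(2) pos
      by (intro tendsto_0_le[OF e, where K=1] always_eventually allI) (simp add: less_imp_le)
  qed
  then have "(\<lambda>k. M k ** (E + e k *\<^sub>R Q)) \<longlonglongrightarrow> Q"
    using tendsto_diff[OF tendsto_const[of Q]] by fastforce
  ultimately show ?thesis
    using that[of M "\<lambda>k. E + e k *\<^sub>R Q"] M(1) by simp
qed

section \<open>Polynomial paths in the reference sets\<close>

text \<open>A linear functional on a product is the sum of its restrictions to the factors.\<close>

lemma polynomial_function_Pair:
  assumes "polynomial_function f" "polynomial_function g"
  shows "polynomial_function (\<lambda>x. (f x, g x))"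
  unfolding polynomial_function_def
proof (intro allI impI)
  fix h :: "'b \<times> 'c \<Rightarrow> real" assume h: "bounded_linear h"
  have "bounded_linear (\<lambda>a. h (a, 0))" "bounded_linear (\<lambda>b. h (0, b))"
    by (intro bounded_linear_compose[OF h] bounded_linear_Pair bounded_linear_ident bounded_linear_zero)+
  then have "real_polynomial_function (\<lambda>x. h (f x, 0))" "real_polynomial_function (\<lambda>x. h (0, g x))"
    using assms unfolding polynomial_function_def by (auto simp: o_def)
  moreover have "h (f x, g x) = h (f x, 0) + h (0, g x)" for x
    using linear_add[OF bounded_linear.linear[OF h], of "(f x, 0)" "(0, g x)"] by simp
  ultimately show "real_polynomial_function (h \<circ> (\<lambda>x. (f x, g x)))"
    by (simp add: o_def real_polynomial_function.intros(3))
qed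

section \<open>Segments in the parameter space\<close>

definition segment :: "'a::real_vector \<Rightarrow> 'a \<Rightarrow> real \<Rightarrow> 'a" where
  "segment a b t = (1 - t) *\<^sub>R a + t *\<^sub>R b"

lemma segment_endpoints [simp]: "segment a b 0 = a" "segment a b 1 = b"
  by (simp_all add: segment_def)

lemma polynomial_function_segment: "polynomial_function (segment a b)"
  unfolding segment_def[abs_def]
  by (intro polynomial_function_add polynomial_function_mult polynomial_function_diff) auto

lemma polynomial_function_segment_mult:
  fixes M N :: "'k::real_or_complex^'n^'l"
  shows "polynomial_function (\<lambda>t. segment M N t ** segment E F t)"
proof -
  have "segment M N t ** segment E F t
    = (1 - t) *\<^sub>R (1 - t) *\<^sub>R (M ** E) + t *\<^sub>R (1 - t) *\<^sub>R (N ** E)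
      + (1 - t) *\<^sub>R t *\<^sub>R (M ** F) + t *\<^sub>R t *\<^sub>R (N ** F)" for t
    by (simp add: segment_def matrix_add_ldistrib matrix_mult_add_left scaleR_matrix_mult
        matrix_mult_scaleR scaleR_right_distrib add.assoc mult.commute)
  then show ?thesis
    by (simp only:) (intro polynomial_function_add polynomial_function_mult polynomial_function_diff;
        auto)
qed

lemma segment_skew:
  assumes "J = - adj J" "K = - adj K"
  shows "segment J K t = - adj (segment J K t)"
proof -
  have "- adj (segment J K t) = segment (- adj J) (- adj K) t"
    by (simp add: segment_def adj_add adj_scaleR)
  also have "\<dots> = segment J K t"
    using assms[symmetric] by (simp only:)
  finally show ?thesis ..
qed

lemma segment_pos_semidef:
  "pos_semidef M \<Longrightarrow> pos_semidef N \<Longrightarrow> t \<in> {0..<1} \<Longrightarrow> pos_semidef (segment M N t)"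
  unfolding segment_def by (intro pos_semidef_combine) auto

lemma segment_0_pos_def: "pos_def M \<Longrightarrow> t \<in> {0..<1} \<Longrightarrow> pos_def (segment M 0 t)"
  using re_quad_form_add[of "1 - t" M 0 0]
  by (auto simp: pos_def_def segment_def adj_scaleR)

text \<open>The coupled constraint on \<open>(E, Q)\<close> holds for every \<open>E\<close> once
  \<open>Q = M E\<close> with \<open>M\<close> semidefinite, because \<open>adj E ** M ** E\<close>
  is a congruence. This is what makes the parameter set convex.\<close>

lemma pos_semidef_product:
  assumes "pos_semidef M"
  shows "adj E ** (M ** E) = adj (M ** E) ** E" "pos_semidef (adj E ** (M ** E))"
  using pos_semidef_congruence[OF assms, of E] assms
  by (auto simp: pos_semidef_def adj_mult matrix_mul_assoc)

text \<open>Each approximant moves along segments in \<open>E\<close>, \<open>J\<close>,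
  \<open>M\<close> and \<open>B\<close>, while \<open>Q\<close> follows as the product
  \<open>M E\<close>.\<close>

lemma Sigma_H_dense:
  fixes J0 M0 :: "'k::real_or_complex^'l^'l" and E0 :: "'k^'n^'l" and B0 :: "'k^'m^'l"
  assumes "J0 = - adj J0" "pos_semidef M0"
  shows "Sigma_H \<subseteq> closure (poly_joined Sigma_H (E0, J0, M0 ** E0, B0))"
proof
  fix x :: "('k, 'l, 'n, 'm) H_tuple"
  assume "x \<in> Sigma_H"
  then obtain E J Q B where x: "x = (E, J, Q, B)" "J = - adj J"
      "adj E ** Q = adj Q ** E" "pos_semidef (adj E ** Q)"
    unfolding Sigma_H_def by blast
  obtain M F where MF: "\<And>k. pos_semidef (M k)" "F \<longlonglongrightarrow> E" "(\<lambda>k. M k ** F k) \<longlonglongrightarrow> Q"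
    using pair_approx[OF x(3,4)] by blast
  have "(F k, J, M k ** F k, B) \<in> poly_joined Sigma_H (E0, J0, M0 ** E0, B0)" for k
    unfolding poly_joined_def mem_Collect_eq
    by (intro exI[of _ "\<lambda>t. (segment (F k) E0 t, segment J J0 t,
            segment (M k) M0 t ** segment (F k) E0 t, segment B B0 t)"] conjI
          polynomial_function_Pair polynomial_function_segment polynomial_function_segment_mult)
       (auto simp: Sigma_H_def assms(2) MF(1)
          intro!: segment_skew[OF x(2) assms(1)] pos_semidef_product segment_pos_semidef)
  moreover have "(\<lambda>k. (F k, J, M k ** F k, B)) \<longlonglongrightarrow> x"
    unfolding x(1) by (intro tendsto_Pair MF tendsto_const)
  ultimately show "x \<in> closure (poly_joined Sigma_H (E0, J0, M0 ** E0, B0))"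
    unfolding closure_sequential by (intro exI conjI allI)
qed

lemma Sigma_sdH_dense:
  fixes J0 M0 :: "'k::real_or_complex^'l^'l" and E0 :: "'k^'n^'l" and B0 :: "'k^'m^'l"
  assumes "J0 = - adj J0" "pos_semidef M0"
  shows "Sigma_sdH \<subseteq> closure (poly_joined Sigma_sdH (E0, J0, 0, M0 ** E0, B0))"
proof
  fix x :: "('k, 'l, 'n, 'm) dH_tuple"
  assume "x \<in> Sigma_sdH"
  then obtain E J R Q B where x: "x = (E, J, R, Q, B)" "J = - adj J" "pos_semidef R"
      "adj E ** Q = adj Q ** E" "pos_semidef (adj E ** Q)"
    unfolding Sigma_sdH_def by blast
  obtain M F where MF: "\<And>k. pos_semidef (M k)" "F \<longlonglongrightarrow> E" "(\<lambda>k. M k ** F k) \<longlonglongrightarrow> Q"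
    using pair_approx[OF x(4,5)] by blast
  have "(F k, J, R, M k ** F k, B) \<in> poly_joined Sigma_sdH (E0, J0, 0, M0 ** E0, B0)" for k
    unfolding poly_joined_def mem_Collect_eq
    by (intro exI[of _ "\<lambda>t. (segment (F k) E0 t, segment J J0 t, segment R 0 t,
            segment (M k) M0 t ** segment (F k) E0 t, segment B B0 t)"] conjI
          polynomial_function_Pair polynomial_function_segment polynomial_function_segment_mult)
       (auto simp: Sigma_sdH_def assms(2) MF(1) x(3)
          intro!: segment_skew[OF x(2) assms(1)] pos_semidef_product segment_pos_semidef)
  moreover have "(\<lambda>k. (F k, J, R, M k ** F k, B)) \<longlonglongrightarrow> x"
    unfolding x(1) by (intro tendsto_Pair MF tendsto_const)
  ultimately show "x \<in> closure (poly_joined Sigma_sdH (E0, J0, 0, M0 ** E0, B0))"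
    unfolding closure_sequential by (intro exI conjI allI)
qed

lemma Sigma_dH_dense:
  fixes J0 M0 :: "'k::real_or_complex^'l^'l" and E0 :: "'k^'n^'l" and B0 :: "'k^'m^'l"
  assumes "J0 = - adj J0" "pos_semidef M0"
  shows "Sigma_dH \<subseteq> closure (poly_joined Sigma_dH (E0, J0, 0, M0 ** E0, B0))"
proof
  fix x :: "('k, 'l, 'n, 'm) dH_tuple"
  assume "x \<in> Sigma_dH"
  then obtain E J R Q B where x: "x = (E, J, R, Q, B)" "J = - adj J" "pos_def R"
      "adj E ** Q = adj Q ** E" "pos_semidef (adj E ** Q)"
    unfolding Sigma_dH_def by blast
  obtain M F where MF: "\<And>k. pos_semidef (M k)" "F \<longlonglongrightarrow> E" "(\<lambda>k. M k ** F k) \<longlonglongrightarrow> Q"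
    using pair_approx[OF x(4,5)] by blast
  have "(F k, J, R, M k ** F k, B) \<in> poly_joined Sigma_dH (E0, J0, 0, M0 ** E0, B0)" for k
    unfolding poly_joined_def mem_Collect_eq
    by (intro exI[of _ "\<lambda>t. (segment (F k) E0 t, segment J J0 t, segment R 0 t,
            segment (M k) M0 t ** segment (F k) E0 t, segment B B0 t)"] conjI
          polynomial_function_Pair polynomial_function_segment polynomial_function_segment_mult)
       (auto simp: Sigma_dH_def assms(2) MF(1) x(3)
          intro!: segment_skew[OF x(2) assms(1)] pos_semidef_product segment_pos_semidef
            segment_0_pos_def)
  moreover have "(\<lambda>k. (F k, J, R, M k ** F k, B)) \<longlonglongrightarrow> x"
    unfolding x(1) by (intro tendsto_Pair MF tendsto_const)
  ultimately show "x \<in> closure (poly_joined Sigma_dH (E0, J0, 0, M0 ** E0, B0))"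
    unfolding closure_sequential by (intro exI conjI allI)
qed

section \<open>Complexification\<close>

definition cmat :: "'k::real_or_complex^'n^'m \<Rightarrow> complex^'n^'m" where
  "cmat M = (\<chi> i j. to_complex (M $ i $ j))"

lemma cmat_mult: "cmat (A ** B) = cmat A ** cmat B"
  by (simp add: cmat_def vec_eq_iff matrix_matrix_mult_def to_complex_sum to_complex_mult)

lemma cmat_hcat: "cmat (hcat A B) = hcat (cmat A) (cmat B)"
  by (simp add: cmat_def hcat_def vec_eq_iff split: sum.splits)

lemma cmat_transpose: "cmat (transpose A) = transpose (cmat A)"
  by (simp add: cmat_def transpose_def)

text \<open>A kernel vector over \<open>'k\<close> is also one over the complex numbers. Injectivity
  is tested on complexified matrices and transferred back in this way.\<close>

lemma rank_cmat_ncols: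
  fixes G :: "'k::real_or_complex^'n^'m"
  assumes "rank (cmat G) = CARD('n)"
  shows "rank G = CARD('n)"
  unfolding rank_eq_ncols_iff
proof (intro allI impI)
  fix x assume "G *v x = 0"
  have "(cmat G *v (\<chi> j. to_complex (x $ j))) $ i = to_complex ((G *v x) $ i)" for i
    by (simp add: cmat_def matrix_vector_mult_def to_complex_sum to_complex_mult)
  then have "cmat G *v (\<chi> j. to_complex (x $ j)) = 0"
    using \<open>G *v x = 0\<close> by (simp add: vec_eq_iff)
  then have "(\<chi> j. to_complex (x $ j)) = 0"
    using assms rank_eq_ncols_iff by blast
  then show "x = 0"
    by (simp add: vec_eq_iff)
qed

lemma rank_cmat_nrows:
  fixes G :: "'k::real_or_complex^'n^'m"
  assumes "rank (cmat G) = CARD('m)"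
  shows "rank G = CARD('m)"
  using rank_cmat_ncols[of "transpose G"] assms by (simp add: cmat_transpose rank_transpose_field)

lemma pencil_complex_mult:
  "pencil_complex z E A B *v vcat x u = z *s (cmat E *v x) - cmat A *v x + cmat B *v u"
  unfolding pencil_complex_def hcat_mult_vcat
  by (simp add: vec_eq_iff cmat_def matrix_vector_mult_def
      left_diff_distrib sum_subtractf sum_distrib_left mult.assoc)

lemma mult_pencil_complex_eq_0_iff:
  "w v* pencil_complex z E A B = 0 \<longleftrightarrow> w v* cmat A = z *s (w v* cmat E) \<and> w v* cmat B = 0"
  unfolding pencil_complex_def mult_hcat_eq_0_iff
  by (simp add: vec_eq_iff cmat_def vector_matrix_mult_def left_diff_distrib right_diff_distrib
      sum_subtractf sum_distrib_left mult_ac) (metis (no_types, lifting))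

section \<open>Eigenvalues of the pencil\<close>

text \<open>Without eigenvalues the characteristic polynomial has no root and is constant by the
  fundamental theorem of algebra. Instead of computing its degree, the proof examines its behaviour
  at infinity.\<close>

lemma complex_eigenvector_exists:
  fixes S :: "complex^'n^'n"
  shows "\<exists>z x. x \<noteq> 0 \<and> S *v x = z *s x"
proof (rule ccontr)
  assume none: "\<not> ?thesis"
  define P where "P = det (\<chi> i j. [:- (S $ i $ j), if i = j then 1 else 0:])"
  have P: "poly P z = det (mat z - S)" for z
    by (auto simp: P_def det_def poly_sum poly_prod mat_def intro!: sum.cong prod.cong)
  have nz: "poly P z \<noteq> 0" for z
  proof -
    have "x = 0" if "(mat z - S) *v x = 0" for x
    proof -
      have "mat z *v x = z *s x"
        by (simp add: vec_eq_iff matrix_vector_mult_def mat_def if_distrib[of "\<lambda>c. c * _"] cong: if_cong)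
      then have "S *v x = z *s x"
        using that by (simp add: matrix_vector_mult_diff_rdistrib)
      then show ?thesis
        using none by blast
    qed
    then show ?thesis
      unfolding P by (metis invertible_det_nz invertible_left_inverse matrix_left_invertible_ker)
  qed
  then have "constant (poly P)"
    using fundamental_theorem_of_algebra by blast
  then obtain c where c: "\<And>z. poly P z = c"
    unfolding constant_def by blast
  \<comment> \<open>The reversed characteristic polynomial tends to 1 as \<open>t\<close> tends to
    0, whereas constancy of \<open>P\<close> forces the limit 0.\<close>
  have scale: "det (mat 1 - t *\<^sub>R S) = complex_of_real t ^ CARD('n) * c" if "t \<noteq> 0" for t
  proof -
    have "mat 1 - t *\<^sub>R S = (\<chi> i. complex_of_real t *s ((mat (inverse (complex_of_real t)) - S) $ i))"
      using that by (auto simp: vec_eq_iff mat_def right_diff_distrib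
          scaleR_conv_of_real[where 'a=complex])
    then have "det (mat 1 - t *\<^sub>R S)
        = complex_of_real t ^ CARD('n) * det (\<chi> i. (mat (inverse (complex_of_real t)) - S) $ i)"
      by (simp only: det_rows_mul) simp
    also have "(\<chi> i. (mat (inverse (complex_of_real t)) - S) $ i) = mat (inverse (complex_of_real t)) - S"
      by (rule vec_lambda_eta)
    finally show ?thesis
      using P[of "inverse (complex_of_real t)"] c by simp
  qed
  have "((\<lambda>t. det (mat 1 - t *\<^sub>R S)) \<longlongrightarrow> det (mat 1 - 0 *\<^sub>R S)) (at 0)"
    unfolding det_def by (intro tendsto_intros)
  moreover have "((\<lambda>t. det (mat 1 - t *\<^sub>R S)) \<longlongrightarrow> complex_of_real 0 ^ CARD('n) * c) (at 0)"
  proof (rule Lim_transform_eventually)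
    show "((\<lambda>t. complex_of_real t ^ CARD('n) * c) \<longlongrightarrow> complex_of_real 0 ^ CARD('n) * c) (at 0)"
      by (intro tendsto_intros)
    show "\<forall>\<^sub>F t in at 0. complex_of_real t ^ CARD('n) * c = det (mat 1 - t *\<^sub>R S)"
      by (auto simp: eventually_at_filter scale)
  qed
  ultimately have "det (mat 1 - 0 *\<^sub>R S) = complex_of_real 0 ^ CARD('n) * c"
    by (rule tendsto_unique[OF at_neq_bot])
  then show False
    by (simp add: zero_power)
qed

text \<open>Multiplication by the inverse \<open>H\<close> of \<open>[E, B]\<close> splits
  \<open>z E x + B u = A x\<close> into \<open>z x = S x\<close> and a formula for \<open>u\<close>.
  Hence every eigenvalue of \<open>S\<close> is a point where the rank drops.\<close>

lemma square_pencil_singular: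
  fixes E A :: "'k::real_or_complex^'n^'l" and B :: "'k^'m^'l"
  assumes full: "rank (cmat (hcat E B)) = CARD('n) + CARD('m)"
    and card: "CARD('l) = CARD('n) + CARD('m)"
  shows "\<exists>z. rank (pencil_complex z E A B) \<noteq> CARD('l)"
proof -
  let ?T = "hcat (cmat E) (cmat B)"
  obtain H where H: "?T ** H = mat 1"
    using full card rank_eq_nrows_iff[of "transpose ?T"] rank_eq_ncols_iff[of "transpose ?T"]
      matrix_left_invertible_ker[of "transpose ?T"]
    by (auto simp: cmat_hcat rank_transpose_field)
       (metis left_invertible_transpose)
  define S where "S = (\<chi> i j. (H ** cmat A) $ Inl i $ j)"
  obtain z x where zx: "x \<noteq> 0" "S *v x = z *s x"
    using complex_eigenvector_exists by blast
  define y where "y = H *v (cmat A *v x)"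
  define u where "u = (\<chi> i. y $ Inr i)"
  have "(\<chi> i. y $ Inl i) = z *s x"
    unfolding zx(2)[symmetric]
    by (simp add: y_def S_def vec_eq_iff matrix_vector_mul_assoc) (simp add: matrix_vector_mult_def)
  then have "y = vcat (z *s x) u"
    using vcat_split[of y] by (simp add: u_def)
  moreover have "?T *v y = cmat A *v x"
    by (simp add: y_def matrix_vector_mul_assoc H matrix_mul_assoc)
  ultimately have "z *s (cmat E *v x) + cmat B *v u = cmat A *v x"
    by (simp add: vector_scalar_commute)
  then have "pencil_complex z E A B *v vcat x u = 0"
    by (simp add: pencil_complex_mult algebra_simps)
  then have "rank (pencil_complex z E A B) \<noteq> CARD('n + 'm)"
    using zx(1) rank_eq_ncols_iff[of "pencil_complex z E A B"] by fastforce
  then show ?thesis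
    using card by auto
qed

section \<open>Controllability of the generic triples\<close>

text \<open>The ranks of \<open>[E, A, B]\<close> and \<open>[E, AZ, B]\<close> are squeezed between
  the rank of \<open>[E, B]\<close> and the number of rows.\<close>

lemma controllable_of_full_row_rank:
  fixes E A :: "'k::real_or_complex^'n^'l" and B :: "'k^'m^'l"
  assumes "rank (hcat E B) = CARD('l)"
  shows "(E, A, B) \<in> freely_initializable" "(E, A, B) \<in> impulse_controllable"
    and "(\<And>z. rank (pencil_complex z E A B) = CARD('l)) \<Longrightarrow>
      (E, A, B) \<in> behavioural_controllable \<inter> completely_controllable \<inter> strongly_controllable"
proof -
  have 1: "rank (hcat E (hcat A B)) = CARD('l)"
    unfolding rank_eq_dim_columns using assms
    by (rule dim_eq_nrows_mono) (auto simp: columns_hcat)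
  have 2: "rank_EAZB E A d Z B = CARD('l)" for d Z
    unfolding rank_EAZB_def using assms
    by (rule dim_eq_nrows_mono) (auto simp: columns_hcat)
  show "(E, A, B) \<in> freely_initializable" "(E, A, B) \<in> impulse_controllable"
    using assms 1 2 by (simp_all add: freely_initializable_def impulse_controllable_def)
  show "(E, A, B) \<in> behavioural_controllable \<inter> completely_controllable \<inter> strongly_controllable"
    if "\<And>z. rank (pencil_complex z E A B) = CARD('l)"
    using assms 1 2 that rank_pencil_rat_nrows[OF assms, of A]
    by (simp add: behavioural_controllable_def completely_controllable_def
        strongly_controllable_def)
qed

text \<open>For injective \<open>E\<close> the matrix \<open>Z\<close> has no columns and is
  admissible. Refuting a condition on all \<open>Z\<close> requires such an instance.\<close>

lemma im_cols_eq_kernel: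
  fixes E :: "'k::real_or_complex^'n^'l"
  assumes "rank E = CARD('n)"
  shows "im_cols (CARD('n) - rank E) Z = {x. E *v x = 0}"
  using assms rank_eq_ncols_iff[of E] by (auto simp: im_cols_def)

lemma rank_EAZB_0: "rank_EAZB E A 0 Z B = rank (hcat E B)"
  by (simp add: rank_EAZB_def rank_eq_dim_columns columns_hcat)

lemma rank_hcat_left:
  fixes E :: "'k::field^'n^'l" and B :: "'k^'m^'l"
  assumes "rank (hcat E B) = CARD('n) + CARD('m)"
  shows "rank E = CARD('n)"
proof -
  have "\<forall>x u. E *v x + B *v u = 0 \<longrightarrow> x = 0 \<and> u = 0"
    using assms rank_eq_ncols_iff[of "hcat E B"] by (simp add: hcat_inj_iff)
  then have "\<forall>x. E *v x = 0 \<longrightarrow> x = 0"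
    by (metis add.right_neutral matrix_vector_mult_0_right)
  then show ?thesis
    by (simp add: rank_eq_ncols_iff)
qed

lemma not_controllable_square:
  fixes E A :: "'k::real_or_complex^'n^'l" and B :: "'k^'m^'l"
  assumes full: "rank (cmat (hcat E B)) = CARD('n) + CARD('m)"
    and card: "CARD('l) = CARD('n) + CARD('m)"
  shows "(E, A, B) \<notin> behavioural_controllable" "(E, A, B) \<notin> completely_controllable"
    "(E, A, B) \<notin> strongly_controllable"
proof -
  obtain z where z: "CARD('l) \<noteq> rank (pencil_complex z E A B)"
    using square_pencil_singular[OF assms] by metis
  have EB: "rank (hcat E B) = CARD('l)"
    using rank_cmat_ncols[of "hcat E B"] full card by simp
  then have E: "rank E = CARD('n)"
    using rank_hcat_left card by metis
  show "(E, A, B) \<notin> behavioural_controllable" "(E, A, B) \<notin> completely_controllable"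
    using z EB rank_pencil_rat_nrows[OF EB, of A]
    by (auto simp: behavioural_controllable_def completely_controllable_def)
  show "(E, A, B) \<notin> strongly_controllable"
    using z EB im_cols_eq_kernel[OF E]
    by (auto simp: strongly_controllable_def Let_def E rank_EAZB_0)
qed

text \<open>The single column \<open>A ** S\<close> already lifts the rank of
  \<open>[E, A, B]\<close> above n + m, the number of columns of \<open>[E, B]\<close>. Since
  \<open>E\<close> is injective, \<open>AZ\<close> is empty and \<open>[E, AZ, B]\<close> has the
  rank of \<open>[E, B]\<close>.\<close>

lemma not_controllable_tall:
  fixes E A :: "'k::real_or_complex^'n^'l" and B :: "'k^'m^'l" and S :: "'k^unit^'n"
  assumes full: "rank (hcat E (hcat (A ** S) B)) = CARD('n) + (1 + CARD('m))"
  shows "(E, A, B) \<notin> freely_initializable" "(E, A, B) \<notin> impulse_controllable"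
    "(E, A, B) \<notin> completely_controllable" "(E, A, B) \<notin> strongly_controllable"
proof -
  have E: "rank E = CARD('n)"
    using full by (intro rank_hcat_left[of E "hcat (A ** S) B"]) simp
  have "columns (A ** S) \<subseteq> vec.span (columns A)"
    by (auto simp: columns_matrix_mult matrix_vector_mult_in_columnspace_gen)
  then have "columns E \<union> (columns (A ** S) \<union> columns B)
      \<subseteq> vec.span (columns E \<union> (columns A \<union> columns B))"
    using vec.span_mono[of "columns A" "columns E \<union> (columns A \<union> columns B)"]
      vec.span_superset[of "columns E \<union> (columns A \<union> columns B)"] by blast
  then have "rank (hcat E (hcat (A ** S) B)) \<le> rank (hcat E (hcat A B))"
    unfolding rank_eq_dim_columns columns_hcat using vec.span_eq_dim vec.dim_mono by blast
  moreover have "rank (hcat E B) \<le> CARD('n) + CARD('m)"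
    using rank_le_ncols[of "hcat E B"] by simp
  ultimately have ne: "rank (hcat E (hcat A B)) \<noteq> rank (hcat E B)"
    using full by simp
  show "(E, A, B) \<notin> freely_initializable" "(E, A, B) \<notin> completely_controllable"
    using ne by (auto simp: freely_initializable_def completely_controllable_def)
  show "(E, A, B) \<notin> impulse_controllable" "(E, A, B) \<notin> strongly_controllable"
    using ne im_cols_eq_kernel[OF E]
    by (auto simp: impulse_controllable_def strongly_controllable_def Let_def E rank_EAZB_0)
qed

section \<open>Numbered components\<close>

definition idx :: "'a::finite \<Rightarrow> nat" where
  "idx = (SOME f. bij_betw f UNIV {0..<CARD('a)})"

lemma bij_idx: "bij_betw (idx :: 'a::finite \<Rightarrow> nat) UNIV {0..<CARD('a)}"
  unfolding idx_def using ex_bij_betw_finite_nat[OF finite] by (rule someI_ex)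

lemma idx_less [simp]: "idx (i :: 'a::finite) < CARD('a)"
  using bij_idx bij_betwE by fastforce

lemma idx_eq_iff [simp]: "idx i = idx j \<longleftrightarrow> i = j"
  using bij_idx by (metis bij_betw_imp_inj_on inj_eq)

definition nth_index :: "nat \<Rightarrow> 'a::finite" where
  "nth_index k = (THE i. idx i = k)"

lemma nth_index_idx [simp]: "nth_index (idx i) = i"
  by (simp add: nth_index_def)

lemma idx_nth_index [simp]: "k < CARD('a) \<Longrightarrow> idx (nth_index k :: 'a::finite) = k"
  using bij_idx by (metis atLeast0LessThan bij_betw_imp_surj_on imageE lessThan_iff nth_index_idx)

text \<open>Out-of-range components are 0, so that index shifts need no case distinctions.\<close>

definition ent :: "'k::zero^'a \<Rightarrow> nat \<Rightarrow> 'k" where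
  "ent x k = (if k < CARD('a) then x $ nth_index k else 0)"

lemma ent_idx [simp]: "ent x (idx i) = x $ i"
  by (simp add: ent_def)

lemma ent_beyond: "CARD('a) \<le> k \<Longrightarrow> ent (x :: 'k::zero^'a) k = 0"
  by (simp add: ent_def)

lemma ent_0 [simp]: "ent 0 k = 0"
  by (simp add: ent_def)

lemma ent_add: "ent (x + y) k = ent x k + ent (y :: 'k::monoid_add^'a) k"
  by (simp add: ent_def)

lemma ent_diff: "ent (x - y) k = ent x k - ent (y :: 'k::group_add^'a) k"
  by (simp add: ent_def)

lemma eq_0_ent: "(\<And>k. k < CARD('a) \<Longrightarrow> ent x k = 0) \<Longrightarrow> (x :: 'k::zero^'a) = 0"
  by (metis ent_idx idx_less vec_eq_iff zero_index)

lemma sum_idx: "(\<Sum>i\<in>UNIV. if idx i = k then x $ i else 0) = ent (x :: 'k::comm_monoid_add^'a) k"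
proof (cases "k < CARD('a)")
  case True
  then have "idx i = k \<longleftrightarrow> i = nth_index k" for i :: 'a
    by auto
  then show ?thesis
    using True by (simp add: ent_def)
next
  case False
  then have "idx i \<noteq> k" for i :: 'a
    using idx_less by metis
  then show ?thesis
    using False by (simp add: ent_def)
qed

text \<open>A rectangular identity moved down by \<open>c\<close> rows. \<open>E\<close> has
  \<open>c = 0\<close>; for \<open>B\<close> the offset decides whether the rows reached by
  \<open>E\<close> and by \<open>B\<close> overlap (\<ell> < n + m), adjoin (\<ell> = n + m) or
  leave a gap (\<ell> > n + m).\<close>

definition shift_mat :: "nat \<Rightarrow> 'k::zero_neq_one^'c^'r" where
  "shift_mat c = (\<chi> i j. if idx i = c + idx j then 1 else 0)"

definition skew_mat :: "'k::ring_1^'r^'r" where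
  "skew_mat = (\<chi> i k. (if Suc (idx i) = idx k then 1 else 0) - (if idx i = Suc (idx k) then 1 else 0))"

lemma mult_shift_mat: "(w v* shift_mat c) $ j = ent (w :: 'k::semiring_1^'r) (c + idx j)"
  by (simp add: vector_matrix_mult_def shift_mat_def if_distrib[of "\<lambda>c. _ * c"] sum_idx cong: if_cong)

lemma shift_mat_mult:
  fixes x :: "'k::ring_1^'c"
  assumes "q < CARD('r)"
  shows "ent (shift_mat c *v x :: 'k^'r) q = (if c \<le> q then ent x (q - c) else 0)"
proof -
  have "ent (shift_mat c *v x :: 'k^'r) q = (\<Sum>j\<in>UNIV. if q = c + idx j then x $ j else 0)"
    using assms by (simp add: ent_def matrix_vector_mult_def shift_mat_def
        if_distrib[of "\<lambda>c. c * _"] cong: if_cong)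
  also have "\<dots> = (\<Sum>j\<in>UNIV. if c \<le> q \<and> idx j = q - c then x $ j else 0)"
    by (intro sum.cong if_cong) auto
  finally show ?thesis
    by (simp add: sum_idx)
qed

lemma mult_skew_mat:
  fixes w :: "'k::ring_1^'r"
  assumes "q < CARD('r)"
  shows "ent (w v* skew_mat) q = (if 0 < q then ent w (q - 1) else 0) - ent w (Suc q)"
proof -
  have "ent (w v* skew_mat) q
      = (\<Sum>i\<in>UNIV. if Suc (idx i) = q then w $ i else 0) - (\<Sum>i\<in>UNIV. if idx i = Suc q then w $ i else 0)"
    using assms by (simp add: ent_def vector_matrix_mult_def skew_mat_def right_diff_distrib
        sum_subtractf if_distrib[of "\<lambda>c. _ * c"] cong: if_cong)
  also have "(\<Sum>i\<in>UNIV. if Suc (idx i) = q then w $ i else 0)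
      = (\<Sum>i\<in>UNIV. if 0 < q \<and> idx i = q - 1 then w $ i else 0)"
    by (intro sum.cong if_cong) auto
  finally show ?thesis
    by (simp add: sum_idx)
qed

lemma skew_mat_mult:
  fixes y :: "'k::ring_1^'r"
  assumes "q < CARD('r)"
  shows "ent (skew_mat *v y) q = ent y (Suc q) - (if 0 < q then ent y (q - 1) else 0)"
proof -
  have "ent (skew_mat *v y) q
      = (\<Sum>k\<in>UNIV. if Suc q = idx k then y $ k else 0) - (\<Sum>k\<in>UNIV. if q = Suc (idx k) then y $ k else 0)"
    using assms by (simp add: ent_def matrix_vector_mult_def skew_mat_def left_diff_distrib
        sum_subtractf if_distrib[of "\<lambda>c. c * _"] cong: if_cong)
  also have "(\<Sum>k\<in>UNIV. if q = Suc (idx k) then y $ k else 0)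
      = (\<Sum>k\<in>UNIV. if 0 < q \<and> idx k = q - 1 then y $ k else 0)"
    by (intro sum.cong if_cong) auto
  finally show ?thesis
    by (simp add: sum_idx eq_commute[of "Suc q"])
qed

lemma skew_mat_skew: "(skew_mat :: 'k::real_or_complex^'r^'r) = - adj skew_mat"
proof -
  have "conjg (if b then 1 else 0 :: 'k) = (if b then 1 else 0)" for b
    by simp
  then show ?thesis
    by (auto simp: skew_mat_def adj_def vec_eq_iff)
qed

lemma cmat_shift_mat [simp]: "cmat (shift_mat c :: 'k::real_or_complex^'c^'r) = shift_mat c"
  by (simp add: cmat_def shift_mat_def vec_eq_iff)

lemma cmat_skew_mat [simp]: "cmat (skew_mat :: 'k::real_or_complex^'r^'r) = skew_mat"
  by (simp add: cmat_def skew_mat_def vec_eq_iff to_complex_diff)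

section \<open>Chains\<close>

text \<open>
  A kernel vector \<open>w\<close> of the pencil at \<open>z\<close> yields the geometric chain
  \<open>z\<^sup>k w\<close>, \<open>k = 0, \<dots>, \<ell>\<close>, which satisfies linear equations not involving
  \<open>z\<close>.  So the absence of nonzero chains, which is an open condition, excludes kernel vectors for
  all \<open>z\<close> at once.  The \<open>\<ell> + 1\<close> members of a chain are indexed by \<^typ>\<open>'l option\<close>.
\<close>

definition chain_index :: "nat \<Rightarrow> 'l::finite option" where
  "chain_index k = (if k < CARD('l) then Some (nth_index k) else None)"

definition chain_pos :: "'l::finite option \<Rightarrow> nat" where
  "chain_pos p = (case p of None \<Rightarrow> CARD('l) | Some i \<Rightarrow> idx i)"

lemma chain_index_idx [simp]: "chain_index (idx i) = Some i"
  by (simp add: chain_index_def)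

lemma chain_index_pos [simp]: "chain_index (chain_pos p) = p"
  by (cases p) (simp_all add: chain_pos_def, simp add: chain_index_def)

lemma chain_pos_index: "k \<le> CARD('l) \<Longrightarrow> chain_pos (chain_index k :: 'l::finite option) = k"
  by (auto simp: chain_index_def chain_pos_def)

lemma chain_pos_le: "chain_pos (p :: 'l::finite option) \<le> CARD('l)"
  by (cases p) (auto simp: chain_pos_def less_imp_le)

text \<open>The coefficient matrix of the equations \<open>w(k+1) E = w(k) A\<close> for the \<ell>
  steps and \<open>w(k) B = 0\<close> for all \<ell> + 1 members, in the stacked unknown
  \<open>w\<close>.\<close>

definition left_chain ::
    "complex^'n^'l \<Rightarrow> complex^'n^'l \<Rightarrow> complex^'m^'l
      \<Rightarrow> complex^('l::finite option \<times> 'l)^(('l \<times> 'n) + ('l option \<times> 'm))" where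
  "left_chain E A B = (\<chi> r c. case r of
      Inl (i, j) \<Rightarrow> (if fst c = chain_index (Suc (idx i)) then E $ snd c $ j else 0)
        - (if fst c = Some i then A $ snd c $ j else 0)
    | Inr (p, k) \<Rightarrow> (if fst c = p then B $ snd c $ k else 0))"

text \<open>The coefficient matrix of \<open>E x(k+1) - A x(k) + B u(k) = 0\<close>. Inputs belong
  to the steps, so there are \<ell> of them but \<ell> + 1 states.\<close>

definition right_chain ::
    "complex^'n^'l \<Rightarrow> complex^'n^'l \<Rightarrow> complex^'m^'l
      \<Rightarrow> complex^(('l::finite option \<times> 'n) + ('l \<times> 'm))^('l \<times> 'l)" where
  "right_chain E A B = (\<chi> r c. case c of
      Inl (p, j) \<Rightarrow> (if p = chain_index (Suc (idx (fst r))) then E $ snd r $ j else 0)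
        - (if p = Some (fst r) then A $ snd r $ j else 0)
    | Inr (i, k) \<Rightarrow> (if i = fst r then B $ snd r $ k else 0))"

lemma sum_pairs: "(\<Sum>c\<in>UNIV. f c) = (\<Sum>p\<in>UNIV. \<Sum>a\<in>UNIV. f (p, a))"
  by (simp add: sum.cartesian_product)

lemma sum_delta_first:
  fixes f :: "'p::finite \<Rightarrow> 'a::finite \<Rightarrow> 'k::semiring_1"
  shows "(\<Sum>p\<in>UNIV. \<Sum>a\<in>UNIV. (if p = q then f p a else 0) * g p a) = (\<Sum>a\<in>UNIV. f q a * g q a)"
proof -
  have "(\<Sum>a\<in>UNIV. (if p = q then f p a else 0) * g p a)
      = (if p = q then \<Sum>a\<in>UNIV. f p a * g p a else 0)" for p
    by simp
  then show ?thesis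
    by simp
qed

lemma left_chain_mult:
  fixes E A :: "complex^'n^'l" and B :: "complex^'m^'l"
  shows "left_chain E A B *v (\<chi> c. w (fst c) $ snd c) = 0 \<longleftrightarrow>
    (\<forall>i. w (chain_index (Suc (idx i))) v* E = w (Some i) v* A) \<and> (\<forall>p. w p v* B = 0)"
proof -
  let ?v = "\<chi> c. w (fst c) $ snd c"
  have "(left_chain E A B *v ?v) $ Inl (i, j)
      = (w (chain_index (Suc (idx i))) v* E) $ j - (w (Some i) v* A) $ j" for i j
  proof -
    have "(left_chain E A B *v ?v) $ Inl (i, j)
        = (\<Sum>p\<in>UNIV. \<Sum>a\<in>UNIV. (if p = chain_index (Suc (idx i)) then E $ a $ j else 0) * w p $ a)
          - (\<Sum>p\<in>UNIV. \<Sum>a\<in>UNIV. (if p = Some i then A $ a $ j else 0) * w p $ a)"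
      by (simp add: left_chain_def matrix_vector_mult_def sum_pairs left_diff_distrib
          sum_subtractf cong: if_cong)
    then show ?thesis
      unfolding sum_delta_first by (simp add: vector_matrix_mult_def mult.commute)
  qed
  moreover have "(left_chain E A B *v ?v) $ Inr (p, k) = (w p v* B) $ k" for p k
  proof -
    have "(left_chain E A B *v ?v) $ Inr (p, k)
        = (\<Sum>q\<in>UNIV. \<Sum>a\<in>UNIV. (if q = p then B $ a $ k else 0) * w q $ a)"
      by (simp add: left_chain_def matrix_vector_mult_def sum_pairs cong: if_cong)
    then show ?thesis
      unfolding sum_delta_first by (simp add: vector_matrix_mult_def mult.commute)
  qed
  ultimately show ?thesis
    by (simp add: vec_eq_iff[of "left_chain E A B *v ?v"] split_sum_all)
       (simp add: vec_eq_iff)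
qed

lemma right_chain_mult:
  fixes E A :: "complex^'n^'l" and B :: "complex^'m^'l"
  shows "right_chain E A B *v vcat (\<chi> c. x (fst c) $ snd c) (\<chi> c. u (fst c) $ snd c) = 0 \<longleftrightarrow>
    (\<forall>i. E *v x (chain_index (Suc (idx i))) - A *v x (Some i) + B *v u i = 0)"
proof -
  let ?v = "vcat (\<chi> c. x (fst c) $ snd c) (\<chi> c. u (fst c) $ snd c)"
  have "(right_chain E A B *v ?v) $ (i, a)
      = (E *v x (chain_index (Suc (idx i))) - A *v x (Some i) + B *v u i) $ a" for i a
  proof -
    have "(right_chain E A B *v ?v) $ (i, a)
        = (\<Sum>p\<in>UNIV. \<Sum>j\<in>UNIV. (if p = chain_index (Suc (idx i)) then E $ a $ j else 0) * x p $ j)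
          - (\<Sum>p\<in>UNIV. \<Sum>j\<in>UNIV. (if p = Some i then A $ a $ j else 0) * x p $ j)
          + (\<Sum>p\<in>UNIV. \<Sum>k\<in>UNIV. (if p = i then B $ a $ k else 0) * u p $ k)"
      by (simp add: right_chain_def matrix_vector_mult_def vcat_def UNIV_Plus_UNIV[symmetric]
          sum.Plus sum_pairs left_diff_distrib sum_subtractf
          del: UNIV_Plus_UNIV cong: if_cong)
    then show ?thesis
      unfolding sum_delta_first by (simp add: matrix_vector_mult_def)
  qed
  then show ?thesis
    by (simp add: vec_eq_iff[of "right_chain E A B *v ?v"])
       (simp add: vec_eq_iff)
qed

text \<open>Two chains are tested: the one supported on the last member gives the rank of
  \<open>[E, B]\<close>, the geometric one the rank of the pencil at \<open>z\<close>.\<close>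

lemma left_chain_injective:
  fixes E A :: "'k::real_or_complex^'n^'l" and B :: "'k^'m^'l"
  assumes inj: "\<forall>v. left_chain (cmat E) (cmat A) (cmat B) *v v = 0 \<longrightarrow> v = 0"
  shows "rank (hcat E B) = CARD('l)" "rank (pencil_complex z E A B) = CARD('l)"
proof -
  let ?L = "left_chain (cmat E) (cmat A) (cmat B)"
  have 1: "w p = 0" if "\<And>i. w (chain_index (Suc (idx i))) v* cmat E = w (Some i) v* cmat A"
    "\<And>p. w p v* cmat B = 0" for w :: "'l option \<Rightarrow> complex^'l" and p
  proof -
    have "(\<chi> c. w (fst c) $ snd c) = 0"
      using that inj left_chain_mult[of "cmat E" "cmat A" "cmat B" w] by blast
    then show ?thesis
      by (simp add: vec_eq_iff)
  qed
  have "rank (cmat (hcat E B)) = CARD('l)"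
    unfolding rank_eq_nrows_iff cmat_hcat mult_hcat_eq_0_iff
  proof (intro allI impI)
    fix w assume w: "w v* cmat E = 0 \<and> w v* cmat B = 0"
    have "(if None = (None :: 'l option) then w else 0) = 0"
      by (rule 1[of "\<lambda>p. if p = None then w else 0"]) (use w in auto)
    then show "w = 0"
      by simp
  qed
  then show "rank (hcat E B) = CARD('l)"
    by (rule rank_cmat_nrows)
  show "rank (pencil_complex z E A B) = CARD('l)"
    unfolding rank_eq_nrows_iff mult_pencil_complex_eq_0_iff
  proof (intro allI impI)
    fix w assume w: "w v* cmat A = z *s (w v* cmat E) \<and> w v* cmat B = 0"
    have scale: "(c *s w) v* M = c *s (w v* M)" for c and M :: "complex^'q^'l"
      by (simp add: vec_eq_iff vector_matrix_mult_def sum_distrib_left mult_ac)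
    \<comment> \<open>Member 0 carries the factor \<open>z ^ 0 = 1\<close>, so \<open>w\<close> is
      recovered even for \<open>z = 0\<close>.\<close>
    have "z ^ chain_pos (chain_index 0 :: 'l option) *s w = 0"
    proof (rule 1[of "\<lambda>p. z ^ chain_pos p *s w"])
      fix i :: 'l
      have "chain_pos (chain_index (Suc (idx i)) :: 'l option) = Suc (idx i)"
        by (rule chain_pos_index) (simp add: Suc_le_eq)
      then show "(z ^ chain_pos (chain_index (Suc (idx i)) :: 'l option) *s w) v* cmat E
          = (z ^ chain_pos (Some i) *s w) v* cmat A"
        using w by (simp add: scale chain_pos_def vec_eq_iff)
    qed (use w in \<open>simp add: scale\<close>)
    then show "w = 0"
      by (simp add: chain_pos_index)
  qed
qed

lemma right_chain_injective:
  fixes E A :: "'k::real_or_complex^'n^'l" and B :: "'k^'m^'l"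
  assumes inj: "\<forall>v. right_chain (cmat E) (cmat A) (cmat B) *v v = 0 \<longrightarrow> v = 0"
  shows "rank (hcat E B) = CARD('n) + CARD('m)"
    "rank (pencil_complex z E A B) = CARD('n) + CARD('m)"
proof -
  have 1: "x p = 0 \<and> u i = 0"
    if "\<And>i. cmat E *v x (chain_index (Suc (idx i))) - cmat A *v x (Some i) + cmat B *v u i = 0"
    for x :: "'l option \<Rightarrow> complex^'n" and u :: "'l \<Rightarrow> complex^'m" and p i
  proof -
    have "vcat (\<chi> c. x (fst c) $ snd c) (\<chi> c. u (fst c) $ snd c) = 0"
      using that inj right_chain_mult[of "cmat E" "cmat A" "cmat B" x u] by blast
    then show ?thesis
      unfolding vcat_eq_0_iff by (simp add: vec_eq_iff)
  qed
  have "\<forall>v. cmat (hcat E B) *v v = 0 \<longrightarrow> v = 0"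
    unfolding cmat_hcat hcat_inj_iff
  proof (intro allI impI)
    fix x u assume xu: "cmat E *v x + cmat B *v u = 0"
    \<comment> \<open>The last step: its equation is the only one containing the final state, and it
      pairs that state with the last input.\<close>
    let ?i = "nth_index (CARD('l) - 1) :: 'l"
    have i: "chain_index (Suc (idx i)) = (None :: 'l option) \<longleftrightarrow> i = ?i" for i :: 'l
    proof -
      have "idx ?i = CARD('l) - 1"
        by simp
      then have "i = ?i \<longleftrightarrow> idx i = CARD('l) - 1"
        by (metis idx_eq_iff)
      moreover have "Suc (idx i) < CARD('l) \<longleftrightarrow> idx i \<noteq> CARD('l) - 1"
        using idx_less[of i] by linarith
      ultimately show ?thesis
        by (simp add: chain_index_def)
    qed
    have "(if None = (None :: 'l option) then x else 0) = 0 \<and> (if ?i = ?i then u else 0) = 0"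
      by (rule 1[of "\<lambda>p. if p = None then x else 0" "\<lambda>i. if i = ?i then u else 0"])
         (use xu in \<open>simp add: i\<close>)
    then show "x = 0 \<and> u = 0"
      by simp
  qed
  then have "rank (cmat (hcat E B)) = CARD('n + 'm)"
    unfolding rank_eq_ncols_iff .
  then show "rank (hcat E B) = CARD('n) + CARD('m)"
    using rank_cmat_ncols by fastforce
  have "\<forall>v. pencil_complex z E A B *v v = 0 \<longrightarrow> v = 0"
  proof (intro allI impI)
    fix v assume v: "pencil_complex z E A B *v v = 0"
    obtain x u where xu: "v = vcat x u"
      using vcat_split by blast
    have eq: "z *s (cmat E *v x) - cmat A *v x + cmat B *v u = 0"
      using v unfolding xu pencil_complex_mult .
    have "z ^ chain_pos (chain_index 0 :: 'l option) *s x = 0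
        \<and> z ^ idx (nth_index 0 :: 'l) *s u = 0"
    proof (rule 1[of "\<lambda>p. z ^ chain_pos p *s x" "\<lambda>i. z ^ idx i *s u"])
      fix i :: 'l
      have "chain_pos (chain_index (Suc (idx i)) :: 'l option) = Suc (idx i)"
        by (rule chain_pos_index) (simp add: Suc_le_eq)
      then have "cmat E *v (z ^ chain_pos (chain_index (Suc (idx i)) :: 'l option) *s x)
          - cmat A *v (z ^ chain_pos (Some i) *s x) + cmat B *v (z ^ idx i *s u)
        = z ^ idx i *s (z *s (cmat E *v x) - cmat A *v x + cmat B *v u)"
        by (simp add: chain_pos_def vec.scale vec_eq_iff algebra_simps)
      then show "cmat E *v (z ^ chain_pos (chain_index (Suc (idx i)) :: 'l option) *s x)
          - cmat A *v (z ^ chain_pos (Some i) *s x) + cmat B *v (z ^ idx i *s u) = 0"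
        by (simp add: eq)
    qed
    then show "v = 0"
      by (simp add: chain_pos_index xu)
  qed
  then show "rank (pencil_complex z E A B) = CARD('n) + CARD('m)"
    using rank_eq_ncols_iff[of "pencil_complex z E A B"] by simp
qed

section \<open>A triple without chains\<close>

lemma mult_skew_shift:
  fixes w :: "'k::comm_ring_1^'l"
  shows "w v* (skew_mat ** (shift_mat c :: 'k^'n^'l)) = (w v* skew_mat) v* shift_mat c"
  by (simp flip: vector_matrix_mul_assoc)

text \<open>The chain equations become \<open>b (k+1) q = b k (q-1) - b k (q+1)\<close>, and
  \<open>B\<close> makes \<open>b k q\<close> vanish for \<open>q \<ge> c\<close>. Solved for
  \<open>b k (q-1)\<close>, the recurrence moves zeros one index down at the price of one chain
  member. Once member 0 vanishes, it propagates zero forward to all members.\<close>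

lemma left_chain_witness:
  fixes v :: "complex^('l::finite option \<times> 'l)"
  assumes card: "CARD('l) < CARD('n) + CARD('m)" and c: "c = min CARD('n) CARD('l) - 1"
    and v: "left_chain (shift_mat 0 :: complex^'n^'l) (skew_mat ** shift_mat 0)
      (shift_mat c :: complex^'m^'l) *v v = 0"
  shows "v = 0"
proof -
  define w where "w p = (\<chi> a. v $ (p, a))" for p
  define b where "b k q = ent (w (chain_index k)) q" for k q
  have "v = (\<chi> c. w (fst c) $ snd c)"
    by (simp add: w_def vec_eq_iff)
  then have eqs: "w (chain_index (Suc (idx i))) v* (shift_mat 0 :: complex^'n^'l)
        = w (Some i) v* (skew_mat ** (shift_mat 0 :: complex^'n^'l))"
      "w p v* (shift_mat c :: complex^'m^'l) = 0" for i p
    using v left_chain_mult[of _ _ _ w] by metis+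
  have "0 < CARD('n)" "0 < CARD('l)" "0 < CARD('m)"
    by simp_all
  \<comment> \<open>\<open>c\<close> is the last row reached by \<open>E\<close>, so the recurrence
    holds up to \<open>q = c\<close>; \<open>B\<close> starting there still reaches the bottom row
    because \<ell> < n + m.\<close>
  then have cpos: "c < CARD('n)" "c < CARD('l)" and ccard: "CARD('l) \<le> c + CARD('m)"
    using card c by linarith+
  have b_ge: "b k q = 0" if "c \<le> q" for k q
  proof (cases "q < CARD('l)")
    case True
    then have "q - c < CARD('m)"
      using ccard that by linarith
    then have "b k q = (w (chain_index k) v* (shift_mat c :: complex^'m^'l)) $ nth_index (q - c)"
      using that by (simp add: b_def mult_shift_mat)
    then show ?thesis
      by (simp add: eqs(2))
  qed (simp add: b_def ent_beyond)
  have b_rec: "b (Suc k) q = (if 0 < q then b k (q - 1) else 0) - b k (Suc q)"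
    if "k < CARD('l)" "q \<le> c" for k q
  proof -
    have q: "q < CARD('n)" "q < CARD('l)"
      using that cpos by linarith+
    define i where "i = (nth_index k :: 'l)"
    have i: "idx i = k"
      using that(1) by (simp add: i_def)
    then have "chain_index k = Some i"
      by (metis chain_index_idx)
    then have "ent (w (chain_index (Suc k))) q = ent (w (chain_index k) v* skew_mat) q"
      using arg_cong[OF eqs(1)[of i], of "\<lambda>y. y $ nth_index q"] q(1) i
      by (simp add: mult_skew_shift mult_shift_mat)
    then show ?thesis
      using q(2) by (simp add: b_def mult_skew_mat)
  qed
  have backward: "\<forall>k q. c - s \<le> q \<longrightarrow> k + s \<le> CARD('l) \<longrightarrow> b k q = 0" for s
  proof (induction s)
    case 0
    then show ?case
      using b_ge by simp
  next
    case (Suc s)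
    show ?case
    proof (intro allI impI)
      fix k q assume kq: "c - Suc s \<le> q" "k + Suc s \<le> CARD('l)"
      show "b k q = 0"
      proof (cases "c - s \<le> q")
        case True
        then show ?thesis
          using Suc kq(2) by simp
      next
        case False
        then have q: "Suc q = c - s"
          using kq(1) by linarith
        then have "Suc q \<le> c"
          by linarith
        then have "b (Suc k) (Suc q) = b k q - b k (Suc (Suc q))"
          using b_rec[of k "Suc q"] kq(2) by simp
        moreover have "b (Suc k) (Suc q) = 0" "b k (Suc (Suc q)) = 0"
          using Suc q kq(2) by auto
        ultimately show ?thesis
          by simp
      qed
    qed
  qed
  have b0: "b 0 q = 0" for q
    using backward[of c] cpos by simp
  have b_zero: "k \<le> CARD('l) \<Longrightarrow> b k q = 0" for k q
  proof (induction k arbitrary: q)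
    case (Suc k)
    then show ?case
      using b_rec[of k q] b_ge[of q] by (cases "q \<le> c") auto
  qed (rule b0)
  have "w p = 0" for p
  proof (rule eq_0_ent)
    fix q
    show "ent (w p) q = 0"
      using b_zero[of "chain_pos p" q] chain_pos_le[of p] by (simp add: b_def)
  qed
  then show ?thesis
    by (simp add: w_def vec_eq_iff)
qed

section \<open>Witnesses for \<ell> = n + m and \<ell> > n + m\<close>

lemma shift_mat_0_ent:
  fixes x :: "complex^'n"
  assumes "CARD('n) \<le> CARD('l)"
  shows "ent ((shift_mat 0 :: complex^'n^'l) *v x) q = ent x q"
proof (cases "q < CARD('l)")
  case True
  then show ?thesis
    by (simp add: shift_mat_mult)
next
  case False
  then show ?thesis
    using assms by (simp add: ent_beyond)
qed

lemma hcat_shift_witness: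
  assumes card: "CARD('l) = CARD('n) + CARD('m)"
    and v: "hcat (shift_mat 0 :: complex^'n^'l) (shift_mat CARD('n) :: complex^'m^'l) *v v = 0"
  shows "v = 0"
proof -
  obtain x u where xu: "v = vcat x u"
    using vcat_split by blast
  have row: "ent x q + (if CARD('n) \<le> q then ent u (q - CARD('n)) else 0) = 0"
    if "q < CARD('l)" for q
    using arg_cong[OF v, of "\<lambda>y. ent y q"] that card
    by (simp add: xu ent_add shift_mat_0_ent) (simp add: shift_mat_mult split: if_splits)
  have "x = 0"
  proof (rule eq_0_ent)
    fix q assume "q < CARD('n)"
    then show "ent x q = 0"
      using row[of q] card by simp
  qed
  moreover have "u = 0"
  proof (rule eq_0_ent)
    fix q assume "q < CARD('m)"
    then show "ent u q = 0"
      using row[of "CARD('n) + q"] card by (simp add: ent_beyond)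
  qed
  ultimately show ?thesis
    by (simp add: xu)
qed

text \<open>Counted from 0, row n is missed by both \<open>E\<close> and \<open>B\<close>. Up to the
  range of \<open>E\<close>, \<open>skew_mat\<close> maps the last column of \<open>E\<close> to
  minus the unit vector of that row.\<close>

lemma hcat_column_witness:
  fixes v :: "complex^('n::finite + (unit + 'm::finite))"
  assumes card: "CARD('l) > CARD('n) + CARD('m)"
    and v: "hcat (shift_mat 0 :: complex^'n^'l)
      (hcat (skew_mat ** shift_mat 0 ** (shift_mat (CARD('n) - 1) :: complex^unit^'n))
        (shift_mat (Suc CARD('n)) :: complex^'m^'l)) *v v = 0"
  shows "v = 0"
proof -
  obtain x y where "v = vcat x y"
    using vcat_split by blast
  moreover obtain s u where "y = vcat s u"
    using vcat_split by blast
  ultimately have xsu: "v = vcat x (vcat s u)"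
    by simp
  define y' where "y' = (shift_mat 0 :: complex^'n^'l) *v ((shift_mat (CARD('n) - 1) :: complex^unit^'n) *v s)"
  have y: "ent y' q = (if q = CARD('n) - 1 then ent s 0 else 0)" for q
  proof (cases "q < CARD('n)")
    case True
    have "CARD('n) - 1 \<le> q \<longleftrightarrow> q = CARD('n) - 1"
      using True by linarith
    then show ?thesis
      using card True by (simp add: y'_def shift_mat_0_ent) (simp add: shift_mat_mult)
  next
    case False
    have "q \<noteq> CARD('n) - 1"
      using False zero_less_card_finite[where 'a='n] by linarith
    then show ?thesis
      using False card by (simp add: y'_def shift_mat_0_ent ent_beyond)
  qed
  have eq: "(shift_mat 0 :: complex^'n^'l) *v x
      + (skew_mat *v y' + (shift_mat (Suc CARD('n)) :: complex^'m^'l) *v u) = 0"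
    using v by (simp add: xsu y'_def flip: matrix_vector_mul_assoc)
  have row: "ent x q + (ent y' (Suc q) - (if 0 < q then ent y' (q - 1) else 0)
      + (if Suc CARD('n) \<le> q then ent u (q - Suc CARD('n)) else 0)) = 0"
    if "q < CARD('l)" for q
    using arg_cong[OF eq, of "\<lambda>y. ent y q"] that
    by (simp add: ent_add shift_mat_mult skew_mat_mult split: if_splits)
  \<comment> \<open>In the gap row only \<open>- ent s 0\<close> survives.\<close>
  have s0: "ent s 0 = 0"
    using row[of "CARD('n)"] card zero_less_card_finite[where 'a='n]
    by (simp add: y ent_beyond split: if_splits)
  then have y0: "ent y' q = 0" for q
    by (simp add: y)
  have "s = 0"
    using s0 by (intro eq_0_ent) simp
  moreover have "x = 0"
  proof (rule eq_0_ent)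
    fix q assume "q < CARD('n)"
    then show "ent x q = 0"
      using row[of q] card by (simp add: y0)
  qed
  moreover have "u = 0"
  proof (rule eq_0_ent)
    fix q assume "q < CARD('m)"
    then show "ent u q = 0"
      using row[of "Suc CARD('n) + q"] card by (simp add: y0 ent_beyond)
  qed
  ultimately show ?thesis
    by (simp add: xsu)
qed

text \<open>The gap row n contains neither an input nor an entry of the next state, so it forces the
  last entry of each state but the final one to vanish. Zeros then spread as for left chains, and
  the rows below the gap give the inputs.\<close>

lemma right_chain_witness:
  fixes v :: "complex^(('l::finite option \<times> 'n::finite) + ('l \<times> 'm::finite))"
  assumes card: "CARD('l) > CARD('n) + CARD('m)"
    and v: "right_chain (shift_mat 0 :: complex^'n^'l) (skew_mat ** shift_mat 0)
      (shift_mat (Suc CARD('n)) :: complex^'m^'l) *v v = 0"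
  shows "v = 0"
proof -
  let ?n = "CARD('n)"
  have n: "0 < ?n"
    by simp
  obtain X U where XU: "v = vcat X U"
    using vcat_split by blast
  define x where "x p = (\<chi> j. X $ (p, j))" for p
  define u where "u i = (\<chi> k. U $ (i, k))" for i
  have "v = vcat (\<chi> c. x (fst c) $ snd c) (\<chi> c. u (fst c) $ snd c)"
    by (simp add: XU x_def u_def)
  then have eqs: "(shift_mat 0 :: complex^'n^'l) *v x (chain_index (Suc (idx i)))
      - skew_mat *v ((shift_mat 0 :: complex^'n^'l) *v x (Some i))
      + (shift_mat (Suc ?n) :: complex^'m^'l) *v u i = 0" for i
    using v right_chain_mult[of _ _ _ x u] by (simp add: matrix_vector_mul_assoc)
  define b where "b k q = ent (x (chain_index k)) q" for k q
  have b_ge: "b k q = 0" if "?n \<le> q" for k q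
    using that by (simp add: b_def ent_beyond)
  have row: "b (Suc k) q - (b k (Suc q) - (if 0 < q then b k (q - 1) else 0))
      + (if Suc ?n \<le> q then ent (u (nth_index k)) (q - Suc ?n) else 0) = 0"
    if "k < CARD('l)" "q < CARD('l)" for k q
  proof -
    have "chain_index k = Some (nth_index k :: 'l)"
      using that by (simp add: chain_index_def)
    then show ?thesis
      using arg_cong[OF eqs[of "nth_index k"], of "\<lambda>y. ent y q"] that card
      by (simp add: b_def ent_add ent_diff shift_mat_0_ent skew_mat_mult shift_mat_mult
          split: if_splits)
  qed
  have b_rec: "b (Suc k) q = b k (Suc q) - (if 0 < q then b k (q - 1) else 0)"
    if "k < CARD('l)" "q \<le> ?n" for k q
    using row[of k q] that card by simp
  \<comment> \<open>The base case concerns index n - 1 and already uses the equation of step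
    \<open>k\<close>, hence \<open>Suc s\<close> and the strict bound.\<close>
  have backward: "\<forall>k q. ?n - Suc s \<le> q \<longrightarrow> k + s < CARD('l) \<longrightarrow> b k q = 0" for s
  proof (induction s)
    case 0
    show ?case
    proof (intro allI impI)
      fix k q assume kq: "?n - Suc 0 \<le> q" "k + 0 < CARD('l)"
      show "b k q = 0"
      proof (cases "?n \<le> q")
        case False
        then have "q = ?n - 1"
          using kq by linarith
        then show ?thesis
          using b_rec[of k ?n] kq(2) b_ge n by simp
      qed (rule b_ge)
    qed
  next
    case (Suc s)
    show ?case
    proof (intro allI impI)
      fix k q assume kq: "?n - Suc (Suc s) \<le> q" "k + Suc s < CARD('l)"
      show "b k q = 0"
      proof (cases "?n - Suc s \<le> q")
        case True
        then show ?thesis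
          using Suc kq(2) by simp
      next
        case False
        then have q: "Suc q = ?n - Suc s"
          using kq(1) by linarith
        then have "Suc q \<le> ?n"
          by linarith
        then have "b (Suc k) (Suc q) = b k (Suc (Suc q)) - b k q"
          using b_rec[of k "Suc q"] kq(2) by simp
        moreover have "b (Suc k) (Suc q) = 0" "b k (Suc (Suc q)) = 0"
          using Suc q kq(2) by auto
        ultimately show ?thesis
          by simp
      qed
    qed
  qed
  have b0: "b 0 q = 0" for q
    using backward[of "?n - 1"] card n by simp
  have b_zero: "k \<le> CARD('l) \<Longrightarrow> b k q = 0" for k q
  proof (induction k arbitrary: q)
    case (Suc k)
    then show ?case
      using b_rec[of k q] b_ge[of q] by (cases "q \<le> ?n") auto
  qed (rule b0)
  have "x p = 0" for p
  proof (rule eq_0_ent)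
    fix q
    show "ent (x p) q = 0"
      using b_zero[of "chain_pos p" q] chain_pos_le[of p] by (simp add: b_def)
  qed
  moreover have "u i = 0" for i
  proof (rule eq_0_ent)
    fix q assume "q < CARD('m)"
    then show "ent (u i) q = 0"
      using row[of "idx i" "Suc ?n + q"] card b_zero by (simp add: Suc_le_eq less_imp_le)
  qed
  ultimately show ?thesis
    unfolding XU vcat_eq_0_iff by (simp add: x_def u_def vec_eq_iff)
qed

section \<open>Genericity in a reference set\<close>

text \<open>What the three reference sets share: a polynomial map to triples and a base point
  reachable from a dense part of \<open>V\<close>. The offset \<open>c\<close> stays free because
  each dimension regime uses its own.\<close>

locale pH_reference_set =
  fixes V :: "'a::euclidean_space set"
    and sys :: "'a \<Rightarrow> ('k::real_or_complex^'n^'l) \<times> ('k^'n^'l) \<times> ('k^'m^'l)"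
  assumes nonempty: "V \<noteq> {}"
    and poly_E: "\<And>i j. complex_polynomial_function (\<lambda>x. to_complex (fst (sys x) $ i $ j))"
    and poly_A: "\<And>i j. complex_polynomial_function (\<lambda>x. to_complex (fst (snd (sys x)) $ i $ j))"
    and poly_B: "\<And>i k. complex_polynomial_function (\<lambda>x. to_complex (snd (snd (sys x)) $ i $ k))"
    and dense: "\<And>c. \<exists>x0. sys x0 = (shift_mat 0, skew_mat ** shift_mat 0, shift_mat c)
      \<and> V \<subseteq> closure (poly_joined V x0)"
begin

definition S :: "(('k^'n^'l) \<times> ('k^'n^'l) \<times> ('k^'m^'l)) set \<Rightarrow> 'a set" where
  "S C = {x \<in> V. sys x \<in> C}"

lemma relative_generic_witness:
  fixes G :: "complex^'n^'l \<Rightarrow> complex^'n^'l \<Rightarrow> complex^'m^'l \<Rightarrow> complex^'c^'r"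
  assumes poly: "\<And>i j. complex_polynomial_function (\<lambda>x.
      G (cmat (fst (sys x))) (cmat (fst (snd (sys x)))) (cmat (snd (snd (sys x)))) $ i $ j)"
    and inj: "\<And>v. G (shift_mat 0) (skew_mat ** shift_mat 0) (shift_mat c) *v v = 0 \<Longrightarrow> v = 0"
    and T: "\<And>x E A B. x \<in> V \<Longrightarrow> sys x = (E, A, B)
      \<Longrightarrow> \<forall>v. G (cmat E) (cmat A) (cmat B) *v v = 0 \<longrightarrow> v = 0 \<Longrightarrow> x \<in> T"
  shows "relative_generic T V"
proof -
  obtain x0 where x0: "sys x0 = (shift_mat 0, skew_mat ** shift_mat 0, shift_mat c)"
      "V \<subseteq> closure (poly_joined V x0)"
    using dense by blast
  show ?thesis
  proof (rule relative_generic_injective[OF poly _ x0(2)])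
    fix v assume "G (cmat (fst (sys x0))) (cmat (fst (snd (sys x0)))) (cmat (snd (snd (sys x0)))) *v v = 0"
    then show "v = 0"
      using inj by (simp add: x0(1) cmat_mult)
  next
    fix x assume "x \<in> V"
      "\<forall>v. G (cmat (fst (sys x))) (cmat (fst (snd (sys x)))) (cmat (snd (snd (sys x)))) *v v = 0 \<longrightarrow> v = 0"
    then show "x \<in> T"
      using T[of x "fst (sys x)" "fst (snd (sys x))" "snd (snd (sys x))"] by simp
  qed
qed

lemma poly_if:
  assumes "complex_polynomial_function f"
  shows "complex_polynomial_function (\<lambda>x. if b then f x else 0)"
  using assms by (cases b) auto

lemma poly_left_chain: "complex_polynomial_function (\<lambda>x. left_chain (cmat (fst (sys x)))
    (cmat (fst (snd (sys x)))) (cmat (snd (snd (sys x)))) $ r $ c)"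
proof (cases r)
  case (Inl ij)
  then show ?thesis
    by (cases ij) (simp add: left_chain_def cmat_def complex_polynomial_function_diff poly_if poly_E
        poly_A cong: if_cong)
next
  case (Inr pk)
  then show ?thesis
    by (cases pk) (simp add: left_chain_def cmat_def poly_if poly_B cong: if_cong)
qed

lemma poly_right_chain: "complex_polynomial_function (\<lambda>x. right_chain (cmat (fst (sys x)))
    (cmat (fst (snd (sys x)))) (cmat (snd (snd (sys x)))) $ r $ c)"
proof (cases c)
  case (Inl pj)
  then show ?thesis
    by (cases pj) (simp add: right_chain_def cmat_def complex_polynomial_function_diff poly_if poly_E
        poly_A cong: if_cong)
next
  case (Inr ik)
  then show ?thesis
    by (cases ik) (simp add: right_chain_def cmat_def poly_if poly_B cong: if_cong)
qed

lemma generic_wide: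
  assumes "CARD('l) < CARD('n) + CARD('m)"
    and "C \<in> {freely_initializable, impulse_controllable, behavioural_controllable,
      completely_controllable, strongly_controllable}"
  shows "relative_generic (S C) V"
\<comment> \<open>\<open>refl\<close> fixes the offset of \<open>B\<close> as
  \<open>min CARD('n) CARD('l) - 1\<close>.\<close>
proof (rule relative_generic_witness[OF poly_left_chain left_chain_witness[OF assms(1) refl]])
  fix x E A B
  assume x: "x \<in> V" "sys x = (E, A, B)"
    and inj: "\<forall>v. left_chain (cmat E) (cmat A) (cmat B) *v v = 0 \<longrightarrow> v = 0"
  have "(E, A, B) \<in> C"
    using assms(2) controllable_of_full_row_rank[OF left_chain_injective(1)[OF inj], of A]
      left_chain_injective(2)[OF inj] by blast
  then show "x \<in> S C"
    using x by (simp add: S_def)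
qed

lemma poly_hcat: "complex_polynomial_function (\<lambda>x. hcat (cmat (fst (sys x)))
    (cmat (snd (snd (sys x)))) $ i $ j)"
  using poly_E poly_B by (cases j) (auto simp: hcat_def cmat_def)

lemma generic_square:
  assumes card: "CARD('l) = CARD('n) + CARD('m)"
  shows "C \<in> {freely_initializable, impulse_controllable} \<Longrightarrow> relative_generic (S C) V"
    and "C \<in> {behavioural_controllable, completely_controllable, strongly_controllable}
      \<Longrightarrow> relative_generic (- S C) V"
proof -
  have full: "rank (cmat (hcat E B)) = CARD('n) + CARD('m)"
    if "\<forall>v. hcat (cmat E) (cmat B) *v v = 0 \<longrightarrow> v = 0" for E :: "'k^'n^'l" and B :: "'k^'m^'l"
    using that rank_eq_ncols_iff[of "cmat (hcat E B)"] by (simp add: cmat_hcat)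
  show "relative_generic (S C) V" if C: "C \<in> {freely_initializable, impulse_controllable}"
  proof (rule relative_generic_witness[OF poly_hcat hcat_shift_witness[OF card]])
    fix x E A B
    assume x: "x \<in> V" "sys x = (E, A, B)"
      and inj: "\<forall>v. hcat (cmat E) (cmat B) *v v = 0 \<longrightarrow> v = 0"
    have "rank (hcat E B) = CARD('l)"
      using rank_cmat_ncols[of "hcat E B"] full[OF inj] card by simp
    then show "x \<in> S C"
      using x C controllable_of_full_row_rank(1,2)[of E B A] by (auto simp: S_def)
  qed
  show "relative_generic (- S C) V"
    if C: "C \<in> {behavioural_controllable, completely_controllable, strongly_controllable}"
  proof (rule relative_generic_witness[OF poly_hcat hcat_shift_witness[OF card]])
    fix x E A B
    assume x: "x \<in> V" "sys x = (E, A, B)"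
      and inj: "\<forall>v. hcat (cmat E) (cmat B) *v v = 0 \<longrightarrow> v = 0"
    then show "x \<in> - S C"
      using C not_controllable_square[OF full[OF inj] card, of A] by (auto simp: S_def)
  qed
qed

lemma generic_tall_behavioural:
  assumes card: "CARD('l) > CARD('n) + CARD('m)"
  shows "relative_generic (S behavioural_controllable) V"
proof (rule relative_generic_witness[OF poly_right_chain right_chain_witness[OF card]])
  fix x E A B
  assume x: "x \<in> V" "sys x = (E, A, B)"
    and inj: "\<forall>v. right_chain (cmat E) (cmat A) (cmat B) *v v = 0 \<longrightarrow> v = 0"
  then show "x \<in> S behavioural_controllable"
    using right_chain_injective[OF inj] rank_pencil_rat_ncols[OF right_chain_injective(1)[OF inj], of A]
    by (simp add: S_def behavioural_controllable_def)
qed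

lemma poly_hcat_column: "complex_polynomial_function (\<lambda>x. hcat (cmat (fst (sys x)))
    (hcat (cmat (fst (snd (sys x))) ** (shift_mat c :: complex^unit^'n)) (cmat (snd (snd (sys x))))) $ i $ j)"
proof (cases j)
  case (Inl j')
  then show ?thesis
    using poly_E by (simp add: hcat_def cmat_def)
next
  case (Inr k)
  show ?thesis
  proof (cases k)
    case (Inl s)
    then show ?thesis
      by (simp add: \<open>j = Inr k\<close> hcat_def cmat_def matrix_matrix_mult_def)
         (intro complex_polynomial_function_sum complex_polynomial_function_mult poly_A
           complex_polynomial_function_const)
  next
    case (Inr k')
    then show ?thesis
      using poly_B \<open>j = Inr k\<close> by (simp add: hcat_def cmat_def)
  qed
qed

lemma generic_tall:
  assumes card: "CARD('l) > CARD('n) + CARD('m)"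
    and C: "C \<in> {freely_initializable, impulse_controllable, completely_controllable,
      strongly_controllable}"
  shows "relative_generic (- S C) V"
proof (rule relative_generic_witness[OF poly_hcat_column hcat_column_witness[OF card]])
  fix x E A B
  assume x: "x \<in> V" "sys x = (E, A, B)"
    and inj: "\<forall>v. hcat (cmat E) (hcat (cmat A ** (shift_mat (CARD('n) - 1) :: complex^unit^'n))
      (cmat B)) *v v = 0 \<longrightarrow> v = 0"
  have "rank (cmat (hcat E (hcat (A ** (shift_mat (CARD('n) - 1) :: 'k^unit^'n)) B)))
      = CARD('n + (unit + 'm))"
    using inj unfolding rank_eq_ncols_iff by (simp add: cmat_hcat cmat_mult)
  from rank_cmat_ncols[OF this]
  have "rank (hcat E (hcat (A ** (shift_mat (CARD('n) - 1) :: 'k^unit^'n)) B))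
      = CARD('n) + (1 + CARD('m))"
    by simp
  then show "x \<in> - S C"
    using not_controllable_tall[of E A "shift_mat (CARD('n) - 1)" B] C x by (auto simp: S_def)
qed

theorem relative_generic_iff:
  shows "relative_generic (S freely_initializable) V \<longleftrightarrow> CARD('l) \<le> CARD('n) + CARD('m)"
    and "relative_generic (S impulse_controllable) V \<longleftrightarrow> CARD('l) \<le> CARD('n) + CARD('m)"
    and "relative_generic (S behavioural_controllable) V \<longleftrightarrow> CARD('l) \<noteq> CARD('n) + CARD('m)"
    and "relative_generic (S completely_controllable) V \<longleftrightarrow> CARD('l) < CARD('n) + CARD('m)"
    and "relative_generic (S strongly_controllable) V \<longleftrightarrow> CARD('l) < CARD('n) + CARD('m)"
    and "\<forall>C \<in> {freely_initializable, impulse_controllable, behavioural_controllable,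
        completely_controllable, strongly_controllable}.
      \<not> relative_generic (S C) V \<longrightarrow> relative_generic (- S C) V"
proof -
  let ?l = "CARD('l)" and ?n = "CARD('n) + CARD('m)"
  have initial: "relative_generic (S C) V \<longleftrightarrow> ?l \<le> ?n"
      "\<not> relative_generic (S C) V \<longrightarrow> relative_generic (- S C) V"
    if C: "C \<in> {freely_initializable, impulse_controllable}" for C
  proof -
    have "relative_generic (S C) V" if "?l \<le> ?n"
      using C that generic_wide[of C] generic_square(1)[of C] by (cases "?l = ?n") auto
    moreover have "relative_generic (- S C) V" if "\<not> ?l \<le> ?n"
      using C that generic_tall[of C] by auto
    ultimately show "relative_generic (S C) V \<longleftrightarrow> ?l \<le> ?n"
        "\<not> relative_generic (S C) V \<longrightarrow> relative_generic (- S C) V"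
      using generic_dichotomy[OF nonempty] by metis+
  qed
  have behavioural: "relative_generic (S behavioural_controllable) V \<longleftrightarrow> ?l \<noteq> ?n"
      "\<not> relative_generic (S behavioural_controllable) V
        \<longrightarrow> relative_generic (- S behavioural_controllable) V"
  proof -
    have "relative_generic (S behavioural_controllable) V" if "?l \<noteq> ?n"
      using that generic_wide[of behavioural_controllable] generic_tall_behavioural by (cases "?l < ?n") auto
    moreover have "relative_generic (- S behavioural_controllable) V" if "\<not> ?l \<noteq> ?n"
      using that generic_square(2) by auto
    ultimately show "relative_generic (S behavioural_controllable) V \<longleftrightarrow> ?l \<noteq> ?n"
        "\<not> relative_generic (S behavioural_controllable) V
          \<longrightarrow> relative_generic (- S behavioural_controllable) V"
      using generic_dichotomy[OF nonempty] by metis+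
  qed
  have combined: "relative_generic (S C) V \<longleftrightarrow> ?l < ?n"
      "\<not> relative_generic (S C) V \<longrightarrow> relative_generic (- S C) V"
    if C: "C \<in> {completely_controllable, strongly_controllable}" for C
  proof -
    have "relative_generic (S C) V" if "?l < ?n"
      using C that generic_wide[of C] by auto
    moreover have "relative_generic (- S C) V" if "\<not> ?l < ?n"
      using C that generic_tall[of C] generic_square(2)[of C] by (cases "?l = ?n") auto
    ultimately show "relative_generic (S C) V \<longleftrightarrow> ?l < ?n"
        "\<not> relative_generic (S C) V \<longrightarrow> relative_generic (- S C) V"
      using generic_dichotomy[OF nonempty] by metis+
  qed
  show "relative_generic (S freely_initializable) V \<longleftrightarrow> ?l \<le> ?n"
    "relative_generic (S impulse_controllable) V \<longleftrightarrow> ?l \<le> ?n"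
    "relative_generic (S behavioural_controllable) V \<longleftrightarrow> ?l \<noteq> ?n"
    "relative_generic (S completely_controllable) V \<longleftrightarrow> ?l < ?n"
    "relative_generic (S strongly_controllable) V \<longleftrightarrow> ?l < ?n"
    by (simp_all add: initial(1) behavioural(1) combined(1))
  show "\<forall>C \<in> {freely_initializable, impulse_controllable, behavioural_controllable,
        completely_controllable, strongly_controllable}.
      \<not> relative_generic (S C) V \<longrightarrow> relative_generic (- S C) V"
    using initial(2) behavioural(2) combined(2) by blast
qed

end

section \<open>The three reference sets as instances\<close>

definition sys_H :: "('k::real_or_complex, 'l::finite, 'n::finite, 'm::finite) H_tuple
    \<Rightarrow> ('k^'n^'l) \<times> ('k^'n^'l) \<times> ('k^'m^'l)" where
  "sys_H = (\<lambda>(E, J, Q, B). (E, J ** Q, B))"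

definition sys_dH :: "('k::real_or_complex, 'l::finite, 'n::finite, 'm::finite) dH_tuple
    \<Rightarrow> ('k^'n^'l) \<times> ('k^'n^'l) \<times> ('k^'m^'l)" where
  "sys_dH = (\<lambda>(E, J, R, Q, B). (E, (J - R) ** Q, B))"

lemma complex_polynomial_function_entry:
  fixes f :: "'a::euclidean_space \<Rightarrow> 'k::real_or_complex^'c^'r"
  assumes "linear f"
  shows "complex_polynomial_function (\<lambda>x. to_complex (f x $ i $ j))"
  by (rule complex_polynomial_function_to_complex, rule linearI)
     (simp_all add: linear_add[OF assms] linear_scale[OF assms])

lemma complex_polynomial_function_product_entry:
  fixes f :: "'a::euclidean_space \<Rightarrow> 'k::real_or_complex^'c^'r"
  assumes "linear f" "linear g"
  shows "complex_polynomial_function (\<lambda>x. to_complex ((f x ** g x) $ i $ j))"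
  by (simp add: matrix_matrix_mult_def to_complex_sum to_complex_mult)
     (intro complex_polynomial_function_sum complex_polynomial_function_mult
       complex_polynomial_function_entry assms)

lemma poly_sys_H:
  "complex_polynomial_function (\<lambda>x. to_complex (fst (sys_H x) $ i $ j))"
  "complex_polynomial_function (\<lambda>x. to_complex (fst (snd (sys_H x)) $ i $ j))"
  "complex_polynomial_function (\<lambda>x. to_complex (snd (snd (sys_H x)) $ i $ k))"
  unfolding sys_H_def case_prod_beta fst_conv snd_conv
  by (intro complex_polynomial_function_entry complex_polynomial_function_product_entry linearI;
      simp)+

lemma poly_sys_dH:
  "complex_polynomial_function (\<lambda>x. to_complex (fst (sys_dH x) $ i $ j))"
  "complex_polynomial_function (\<lambda>x. to_complex (fst (snd (sys_dH x)) $ i $ j))"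
  "complex_polynomial_function (\<lambda>x. to_complex (snd (snd (sys_dH x)) $ i $ k))"
  unfolding sys_dH_def case_prod_beta fst_conv snd_conv
  by (intro complex_polynomial_function_entry complex_polynomial_function_product_entry linearI;
      simp add: algebra_simps)+

lemma pos_semidef_mat_1: "pos_semidef (mat 1)"
  by (simp add: pos_def_imp_pos_semidef)

interpretation H: pH_reference_set Sigma_H sys_H
proof (standard, goal_cases)
  case 1
  have "(0, 0, 0, 0) \<in> Sigma_H"
    by (simp add: Sigma_H_def)
  then show ?case
    by blast
next
  case (5 c)
  show ?case
    using Sigma_H_dense[OF skew_mat_skew pos_semidef_mat_1, of "shift_mat 0" "shift_mat c"]
    by (intro exI[of _ "(shift_mat 0, skew_mat, mat 1 ** shift_mat 0, shift_mat c)"])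
       (simp add: sys_H_def)
qed (rule poly_sys_H)+

interpretation sdH: pH_reference_set Sigma_sdH sys_dH
proof (standard, goal_cases)
  case 1
  have "(0, 0, 0, 0, 0) \<in> Sigma_sdH"
    by (simp add: Sigma_sdH_def)
  then show ?case
    by blast
next
  case (5 c)
  show ?case
    using Sigma_sdH_dense[OF skew_mat_skew pos_semidef_mat_1, of "shift_mat 0" "shift_mat c"]
    by (intro exI[of _ "(shift_mat 0, skew_mat, 0, mat 1 ** shift_mat 0, shift_mat c)"])
       (simp add: sys_dH_def)
qed (rule poly_sys_dH)+

interpretation dH: pH_reference_set Sigma_dH sys_dH
proof (standard, goal_cases)
  case 1
  have "(0, 0, mat 1, 0, 0) \<in> Sigma_dH"
    by (simp add: Sigma_dH_def)
  then show ?case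
    by blast
next
  case (5 c)
  show ?case
    using Sigma_dH_dense[OF skew_mat_skew pos_semidef_mat_1, of "shift_mat 0" "shift_mat c"]
    by (intro exI[of _ "(shift_mat 0, skew_mat, 0, mat 1 ** shift_mat 0, shift_mat c)"])
       (simp add: sys_dH_def)
qed (rule poly_sys_dH)+

lemma S_H_eq: "S_H C = H.S C"
  unfolding H.S_def by (auto simp: S_H_def sys_H_def)

lemma S_sdH_eq: "S_sdH C = sdH.S C"
  unfolding sdH.S_def by (auto simp: S_sdH_def sys_dH_def)

lemma S_dH_eq: "S_dH C = dH.S C"
  unfolding dH.S_def by (auto simp: S_dH_def sys_dH_def)

theorem theorem4p1:
  shows
    "(relative_generic (S_H freely_initializable) (Sigma_H :: ('k::real_or_complex, 'l::finite, 'n::finite, 'm::finite) H_tuple set)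
       \<longleftrightarrow> CARD('l) \<le> CARD('n) + CARD('m))
   \<and> (relative_generic (S_H impulse_controllable) (Sigma_H :: ('k, 'l, 'n, 'm) H_tuple set)
       \<longleftrightarrow> CARD('l) \<le> CARD('n) + CARD('m))
   \<and> (relative_generic (S_H behavioural_controllable) (Sigma_H :: ('k, 'l, 'n, 'm) H_tuple set)
       \<longleftrightarrow> CARD('l) \<noteq> CARD('n) + CARD('m))
   \<and> (relative_generic (S_H completely_controllable) (Sigma_H :: ('k, 'l, 'n, 'm) H_tuple set)
       \<longleftrightarrow> CARD('l) < CARD('n) + CARD('m))
   \<and> (relative_generic (S_H strongly_controllable) (Sigma_H :: ('k, 'l, 'n, 'm) H_tuple set)
       \<longleftrightarrow> CARD('l) < CARD('n) + CARD('m))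
   \<and> (\<forall>C \<in> {freely_initializable, impulse_controllable, behavioural_controllable,
            completely_controllable, strongly_controllable}.
       \<not> relative_generic (S_H C) (Sigma_H :: ('k, 'l, 'n, 'm) H_tuple set)
       \<longrightarrow> relative_generic (- S_H C) (Sigma_H :: ('k, 'l, 'n, 'm) H_tuple set))
   \<and> (relative_generic (S_sdH freely_initializable) (Sigma_sdH :: ('k, 'l, 'n, 'm) dH_tuple set)
       \<longleftrightarrow> CARD('l) \<le> CARD('n) + CARD('m))
   \<and> (relative_generic (S_sdH impulse_controllable) (Sigma_sdH :: ('k, 'l, 'n, 'm) dH_tuple set)
       \<longleftrightarrow> CARD('l) \<le> CARD('n) + CARD('m))
   \<and> (relative_generic (S_sdH behavioural_controllable) (Sigma_sdH :: ('k, 'l, 'n, 'm) dH_tuple set)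
       \<longleftrightarrow> CARD('l) \<noteq> CARD('n) + CARD('m))
   \<and> (relative_generic (S_sdH completely_controllable) (Sigma_sdH :: ('k, 'l, 'n, 'm) dH_tuple set)
       \<longleftrightarrow> CARD('l) < CARD('n) + CARD('m))
   \<and> (relative_generic (S_sdH strongly_controllable) (Sigma_sdH :: ('k, 'l, 'n, 'm) dH_tuple set)
       \<longleftrightarrow> CARD('l) < CARD('n) + CARD('m))
   \<and> (\<forall>C \<in> {freely_initializable, impulse_controllable, behavioural_controllable,
            completely_controllable, strongly_controllable}.
       \<not> relative_generic (S_sdH C) (Sigma_sdH :: ('k, 'l, 'n, 'm) dH_tuple set)
       \<longrightarrow> relative_generic (- S_sdH C) (Sigma_sdH :: ('k, 'l, 'n, 'm) dH_tuple set))
   \<and> (relative_generic (S_dH freely_initializable) (Sigma_dH :: ('k, 'l, 'n, 'm) dH_tuple set)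
       \<longleftrightarrow> CARD('l) \<le> CARD('n) + CARD('m))
   \<and> (relative_generic (S_dH impulse_controllable) (Sigma_dH :: ('k, 'l, 'n, 'm) dH_tuple set)
       \<longleftrightarrow> CARD('l) \<le> CARD('n) + CARD('m))
   \<and> (relative_generic (S_dH behavioural_controllable) (Sigma_dH :: ('k, 'l, 'n, 'm) dH_tuple set)
       \<longleftrightarrow> CARD('l) \<noteq> CARD('n) + CARD('m))
   \<and> (relative_generic (S_dH completely_controllable) (Sigma_dH :: ('k, 'l, 'n, 'm) dH_tuple set)
       \<longleftrightarrow> CARD('l) < CARD('n) + CARD('m))
   \<and> (relative_generic (S_dH strongly_controllable) (Sigma_dH :: ('k, 'l, 'n, 'm) dH_tuple set)
       \<longleftrightarrow> CARD('l) < CARD('n) + CARD('m))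
   \<and> (\<forall>C \<in> {freely_initializable, impulse_controllable, behavioural_controllable,
            completely_controllable, strongly_controllable}.
       \<not> relative_generic (S_dH C) (Sigma_dH :: ('k, 'l, 'n, 'm) dH_tuple set)
       \<longrightarrow> relative_generic (- S_dH C) (Sigma_dH :: ('k, 'l, 'n, 'm) dH_tuple set))"
  unfolding S_H_eq S_sdH_eq S_dH_eq
  by (intro conjI H.relative_generic_iff sdH.relative_generic_iff dH.relative_generic_iff)

end
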